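(* Let $k$ be a positive integer. Every $\lceil 12.5k-6\rceil$-connected tournament $T$ with minimum out-degree $\delta^{+}(T)\geq 21k-14$ is $k$-linked.
   Context: A tournament is a finite digraph with exactly one arc between every pair of distinct vertices. For a digraph $D$, $\delta^{+}(D)$ is the minimum out-degree of a vertex of $D$. A dipath from $u$ to $v$ is a sequence of distinct vertices $u=w_0,w_1,\dots,w_t=v$ with $(w_j,w_{j+1})$ an arc for all $j$. A digraph is (strongly) connected if for any two vertices $u,v$ there is a dipath from $u$ to $v$; a digraph is $m$-connected if it remains connected after the removal of any set of at most $m-1$ vertices. A digraph $D$ is $k$-linked if for any two disjoint vertex sets $\{x_1,\dots,x_k\}$ and $\{y_1,\dots,y_k\}$ of $D$ there are pairwise vertex-disjoint dipaths $P_1,\dots,P_k$ with $P_i$ a dipath from $x_i$ to $y_i$ for each $i\in\{1,\dots,k\}$. *)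

theory Defs
  imports Complex_Main "HOL-Library.Disjoint_Sets" "Graph_Theory.Graph_Theory"
begin

locale tournament = digraph T for T :: "('a, 'b) pre_digraph" +
  assumes unique_arc:
    "\<lbrakk>u \<in> verts T; v \<in> verts T; u \<noteq> v\<rbrakk> \<Longrightarrow>
      \<exists>!e. e \<in> arcs T \<and> (arc_to_ends T e = (u, v) \<or> arc_to_ends T e = (v, u))"

text \<open>Only meaningful for a finite nonempty vertex set, where the minimum exists.\<close>

definition min_out_degree :: "('a, 'b) pre_digraph \<Rightarrow> nat" where
  "min_out_degree G = Min (out_degree G ` verts G)"

definition dipath :: "('a, 'b) pre_digraph \<Rightarrow> 'a \<Rightarrow> 'a list \<Rightarrow> 'a \<Rightarrow> bool" where
  "dipath G u p v \<longleftrightarrow> vpath p G \<and> hd p = u \<and> last p = v"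

text \<open>
  The library's strong connectedness is phrased through reachability and excludes the null
  digraph; otherwise it is the existence of a dipath between any two vertices.
\<close>

lemma (in wf_digraph) strongly_connected_iff_dipath:
  "strongly_connected G \<longleftrightarrow>
    verts G \<noteq> {} \<and> (\<forall>u\<in>verts G. \<forall>v\<in>verts G. \<exists>p. dipath G u p v)"
  unfolding strongly_connected_def dipath_def
  using reachable_vpath_conv by metis

text \<open>
  Since the null digraph is not strongly connected, an \<open>m\<close>-connected digraph has at least
  \<open>m\<close> vertices.
\<close>

definition m_connected :: "nat \<Rightarrow> ('a, 'b) pre_digraph \<Rightarrow> bool" where
  "m_connected m G \<longleftrightarrow>
    (\<forall>S. S \<subseteq> verts G \<and> finite S \<and> card S < m \<longrightarrow> strongly_connected (G \<restriction> (verts G - S)))"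

text \<open>
  The sets of sources and sinks have exactly \<open>k\<close> elements each, hence the injectivity of
  their enumerations.
\<close>

definition k_linked :: "nat \<Rightarrow> ('a, 'b) pre_digraph \<Rightarrow> bool" where
  "k_linked k G \<longleftrightarrow>
    (\<forall>x y. x ` {1..k} \<subseteq> verts G \<and> y ` {1..k} \<subseteq> verts G \<and>
        inj_on x {1..k} \<and> inj_on y {1..k} \<and> x ` {1..k} \<inter> y ` {1..k} = {} \<longrightarrow>
      (\<exists>P. (\<forall>i\<in>{1..k}. dipath G (x i) (P i) (y i)) \<and>
           disjoint_family_on (\<lambda>i. set (P i)) {1..k}))"

end

theory Submission
  imports Defs
begin

text \<open>
  Let \<open>H\<close> be \<open>T\<close> without the terminals. Take the \<open>3 k - 1\<close> vertices \<open>v\<close> of lowest out-degree in \<open>H\<close>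
  and extend each to a gadget \<open>v, b v, u v\<close> with exit \<open>u v\<close>, where \<open>b v\<close> and \<open>u v\<close> are chosen among the
  out-neighbours of \<open>v\<close> so that the vertices outside the gadgets dominated by all three number at most
  a quarter of the out-degree of \<open>v\<close>, hence of that of any vertex of \<open>H\<close> not among the chosen \<open>v\<close>.
  An averaging argument gives every source \<open>x i\<close> two private vertices \<open>x' i\<close>, \<open>x'' i\<close> that together
  enter at least \<open>2 k\<close> gadgets. Reserve these and all \<open>v\<close>, \<open>b v\<close>, and let Menger's theorem provide
  disjoint paths of minimal total length from the exits to the sinks \<open>y i\<close>. By minimality an exit that
  starts no path has out-neighbours only among the first two vertices of each path, so
  \<open>x i\<close> can be led into an unused gadget and from its exit, through one vertex off the paths, into the
  gadget where the path to \<open>y i\<close> begins.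
\<close>

section \<open>Menger's theorem\<close>

text \<open>Paths in a relation, so that arcs can be removed one at a time.\<close>

definition rwalk :: "('a \<times> 'a) set \<Rightarrow> 'a list \<Rightarrow> bool" where
  "rwalk E p \<longleftrightarrow> p \<noteq> [] \<and> successively (\<lambda>u v. (u, v) \<in> E) p"

definition rpath :: "('a \<times> 'a) set \<Rightarrow> 'a set \<Rightarrow> 'a set \<Rightarrow> 'a list \<Rightarrow> bool" where
  "rpath E A B p \<longleftrightarrow> rwalk E p \<and> distinct p \<and> hd p \<in> A \<and> last p \<in> B"

text \<open>Stated for walks rather than paths, so that pieces of walks can be concatenated without
  first being made simple.\<close>

definition separates :: "('a \<times> 'a) set \<Rightarrow> 'a set \<Rightarrow> 'a set \<Rightarrow> 'a set \<Rightarrow> bool" where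
  "separates E A B X \<longleftrightarrow> (\<forall>p. rwalk E p \<and> hd p \<in> A \<and> last p \<in> B \<longrightarrow> set p \<inter> X \<noteq> {})"

lemma rwalk_append:
  assumes "rwalk E p" "rwalk E q" "(last p, hd q) \<in> E"
  shows "rwalk E (p @ q)"
  using assms by (auto simp: rwalk_def successively_append_iff)

lemma rwalk_append_tl:
  assumes "rwalk E p" "rwalk E q" "last p = hd q"
  shows "rwalk E (p @ tl q)"
proof (cases "tl q")
  case Nil
  then show ?thesis using assms by simp
next
  case (Cons a r)
  with assms(2) have "q = hd q # a # r" by (metis rwalk_def list.collapse)
  with assms(2) have "successively (\<lambda>u v. (u, v) \<in> E) (hd q # a # r)"
    by (metis rwalk_def)
  then show ?thesis
    using assms Cons by (auto simp: rwalk_def successively_append_iff)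
qed

lemma last_append_tl: "q \<noteq> [] \<Longrightarrow> last p = hd q \<Longrightarrow> last (p @ tl q) = last q"
  by (cases q) (auto simp: last_append)

lemma set_append_tl: "p \<noteq> [] \<Longrightarrow> q \<noteq> [] \<Longrightarrow> last p = hd q \<Longrightarrow> set (p @ tl q) = set p \<union> set q"
  by (cases q) (use last_in_set[of p] in auto)

lemma rwalk_split: "rwalk E (p @ v # q) \<longleftrightarrow> rwalk E (p @ [v]) \<and> rwalk E (v # q)"
  by (cases q) (auto simp: rwalk_def successively_append_iff)

lemma rwalk_mono: "rwalk E p \<Longrightarrow> E \<subseteq> F \<Longrightarrow> rwalk F p"
  unfolding rwalk_def by (auto intro: successively_mono)

text \<open>Cutting out the segment between two occurrences of a vertex shortens the walk and keeps
  its ends; induction on the length does the rest.\<close>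

lemma rwalk_imp_rpath:
  assumes "rwalk E p"
  obtains q where "rpath E {hd p} {last p} q" "set q \<subseteq> set p"
proof -
  have "\<exists>q. rpath E {hd p} {last p} q \<and> set q \<subseteq> set p"
    using assms
  proof (induction "length p" arbitrary: p rule: less_induct)
    case less
    show ?case
    proof (cases "distinct p")
      case True
      then show ?thesis using less.prems by (auto simp: rpath_def)
    next
      case False
      then obtain as x bs cs where p: "p = as @ [x] @ bs @ [x] @ cs"
        using not_distinct_decomp by blast
      have 1: "rwalk E (as @ [x])" using less.prems rwalk_split[of E as x "bs @ [x] @ cs"] by (simp add: p)
      have 2: "rwalk E ([x] @ cs)" using less.prems rwalk_split[of E "as @ x # bs" x cs] by (simp add: p)
      let ?p = "(as @ [x]) @ tl ([x] @ cs)"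
      have w: "rwalk E ?p" by (rule rwalk_append_tl[OF 1 2]) simp
      have "length ?p < length p" by (simp add: p)
      from less.hyps[OF this w] obtain q where
        "rpath E {hd ?p} {last ?p} q" "set q \<subseteq> set ?p" by blast
      moreover have "hd ?p = hd p" "last ?p = last p" "set ?p \<subseteq> set p"
        by (auto simp: p hd_append)
      ultimately show ?thesis by (metis order_trans)
    qed
  qed
  then show ?thesis using that by blast
qed

text \<open>If the new arc is used, \<open>q\<close> is the part before its first use and
  \<open>r\<close> the part after its last; what lies between is dropped.\<close>

lemma rwalk_insert_cases:
  assumes "rwalk (insert (x, y) E) p"
  obtains "rwalk E p"
  | q r where "rwalk E q" "hd q = hd p" "last q = x" "rwalk E r" "hd r = y" "last r = last p"
      "set q \<subseteq> set p" "set r \<subseteq> set p"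
proof -
  have "rwalk E p \<or> (\<exists>q r. rwalk E q \<and> hd q = hd p \<and> last q = x \<and> rwalk E r \<and> hd r = y \<and>
      last r = last p \<and> set q \<subseteq> set p \<and> set r \<subseteq> set p)"
    using assms
  proof (induction p)
    case Nil
    then show ?case by (simp add: rwalk_def)
  next
    case (Cons a p)
    show ?case
    proof (cases p)
      case Nil
      then show ?thesis by (simp add: rwalk_def)
    next
      case (Cons b p')
      with Cons.prems have ab: "(a, b) = (x, y) \<or> (a, b) \<in> E"
        and w: "rwalk (insert (x, y) E) p" by (auto simp: rwalk_def)
      from Cons.IH[OF w] show ?thesis
      proof (elim disjE exE conjE)
        assume p: "rwalk E p"
        from ab show ?thesis
        proof
          assume "(a, b) = (x, y)"
          then show ?thesis using p Cons
            by (intro disjI2 exI[of _ "[a]"] exI[of _ p]) (auto simp: rwalk_def)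
        next
          assume "(a, b) \<in> E"
          then show ?thesis using p Cons by (intro disjI1) (auto simp: rwalk_def)
        qed
      next
        fix q r
        assume h: "rwalk E q" "hd q = hd p" "last q = x" "rwalk E r" "hd r = y"
          "last r = last p" "set q \<subseteq> set p" "set r \<subseteq> set p"
        from ab show ?thesis
        proof
          assume "(a, b) = (x, y)"
          then show ?thesis using h Cons
            by (intro disjI2 exI[of _ "[a]"] exI[of _ r]) (auto simp: rwalk_def)
        next
          assume "(a, b) \<in> E"
          then have "rwalk E (a # q)" using h Cons
            by (cases q) (auto simp: rwalk_def)
          moreover have "q \<noteq> []" using h by (simp add: rwalk_def)
          ultimately show ?thesis using h Cons
            by (intro disjI2 exI[of _ "a # q"] exI[of _ r]) auto
        qed
      qed
    qed
  qed
  then show ?thesis using that by blast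
qed

section \<open>Families of disjoint paths\<close>

definition connector :: "('a \<times> 'a) set \<Rightarrow> 'a set \<Rightarrow> 'a set \<Rightarrow> 'i set \<Rightarrow> ('i \<Rightarrow> 'a list) \<Rightarrow> bool" where
  "connector E A B I P \<longleftrightarrow> (\<forall>i\<in>I. rpath E A B (P i)) \<and> disjoint_family_on (\<lambda>i. set (P i)) I"

lemma connector_reindex:
  assumes "connector E A B I P" "inj_on f J" "f ` J \<subseteq> I"
  shows "connector E A B J (P \<circ> f)"
  using assms unfolding connector_def disjoint_family_on_def inj_on_def
  by (auto simp: image_subset_iff) blast

lemma rpath_nonempty: "rpath E A B p \<Longrightarrow> p \<noteq> []"
  by (simp add: rpath_def rwalk_def)

text \<open>Disjoint paths have distinct last vertices. With as many paths as vertices in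
  \<open>B\<close>, taking the last vertex is therefore a bijection onto \<open>B\<close>, and its
  inverse reindexes the family.\<close>

lemma connector_by_last:
  assumes "connector E A B I P" "finite B" "card I = card B" "finite I"
  obtains Q where "connector E A B B Q" "\<And>b. b \<in> B \<Longrightarrow> last (Q b) = b"
proof -
  let ?f = "\<lambda>i. last (P i)"
  have inj: "inj_on ?f I"
  proof (rule inj_onI)
    fix i j assume ij: "i \<in> I" "j \<in> I" "last (P i) = last (P j)"
    then have "last (P i) \<in> set (P i) \<inter> set (P j)"
      using assms(1) rpath_nonempty by (metis IntI connector_def last_in_set)
    then show "i = j" using assms(1) ij
      by (metis connector_def disjoint_family_on_def empty_iff)
  qed
  have "?f ` I \<subseteq> B" using assms(1) by (auto simp: connector_def rpath_def)
  then have im: "?f ` I = B" using inj assms by (simp add: card_image card_subset_eq)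
  let ?g = "inv_into I ?f"
  have g: "inj_on ?g B" "?g ` B \<subseteq> I" "\<And>b. b \<in> B \<Longrightarrow> ?f (?g b) = b"
    using im by (auto intro: inj_on_inv_into inv_into_into f_inv_into_f)
  show ?thesis
    using that[of "P \<circ> ?g"] connector_reindex[OF assms(1) g(1,2)] g(3) by simp
qed

lemma connector_by_hd:
  assumes "connector E A B I P" "finite A" "card I = card A" "finite I"
  obtains Q where "connector E A B A Q" "\<And>a. a \<in> A \<Longrightarrow> hd (Q a) = a"
proof -
  let ?f = "\<lambda>i. hd (P i)"
  have inj: "inj_on ?f I"
  proof (rule inj_onI)
    fix i j assume ij: "i \<in> I" "j \<in> I" "hd (P i) = hd (P j)"
    then have "hd (P i) \<in> set (P i) \<inter> set (P j)"
      using assms(1) rpath_nonempty by (metis IntI connector_def hd_in_set)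
    then show "i = j" using assms(1) ij
      by (metis connector_def disjoint_family_on_def empty_iff)
  qed
  have "?f ` I \<subseteq> A" using assms(1) by (auto simp: connector_def rpath_def)
  then have im: "?f ` I = A" using inj assms by (simp add: card_image card_subset_eq)
  let ?g = "inv_into I ?f"
  have g: "inj_on ?g A" "?g ` A \<subseteq> I" "\<And>b. b \<in> A \<Longrightarrow> ?f (?g b) = b"
    using im by (auto intro: inj_on_inv_into inv_into_into f_inv_into_f)
  show ?thesis
    using that[of "P \<circ> ?g"] connector_reindex[OF assms(1) g(1,2)] g(3) by simp
qed

lemma connector_from_walks:
  assumes "\<And>i. i \<in> I \<Longrightarrow> rwalk E (W i) \<and> hd (W i) \<in> A \<and> last (W i) \<in> B"
    and "disjoint_family_on (\<lambda>i. set (W i)) I"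
  obtains P where "connector E A B I P"
    "\<And>i. i \<in> I \<Longrightarrow> hd (P i) = hd (W i) \<and> last (P i) = last (W i) \<and> set (P i) \<subseteq> set (W i)"
proof -
  have "\<forall>i\<in>I. \<exists>q. rpath E {hd (W i)} {last (W i)} q \<and> set q \<subseteq> set (W i)"
    using assms(1) rwalk_imp_rpath by metis
  then obtain P where P: "\<And>i. i \<in> I \<Longrightarrow> rpath E {hd (W i)} {last (W i)} (P i)"
      "\<And>i. i \<in> I \<Longrightarrow> set (P i) \<subseteq> set (W i)" by metis
  have "disjoint_family_on (\<lambda>i. set (P i)) I"
    using assms(2) P(2) unfolding disjoint_family_on_def by blast
  moreover have "\<And>i. i \<in> I \<Longrightarrow> hd (P i) = hd (W i) \<and> last (P i) = last (W i)"
    using P by (simp add: rpath_def)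
  ultimately show ?thesis using that[of P] assms(1) P by (auto simp: connector_def rpath_def)
qed

text \<open>Goering's proof: delete an arc \<open>(x, y)\<close>. If this creates a separator \<open>S\<close> that is too small, join
  a connector from \<open>A\<close> to \<open>S \<union> {x}\<close> to one from \<open>S \<union> {y}\<close> to \<open>B\<close>; the two families meet in \<open>S\<close> only.\<close>

theorem menger:
  fixes E :: "('a \<times> 'a) set"
  assumes "finite E" "finite A" "irrefl E"
    and "\<And>X. finite X \<Longrightarrow> separates E A B X \<Longrightarrow> s \<le> card X"
  obtains I :: "'a set" and P where "card I = s" "finite I" "connector E A B I P"
proof -
  have "\<exists>(I::'a set) P. card I = s \<and> finite I \<and> connector E A B I P"
    using assms
  proof (induction E arbitrary: A B rule: finite_induct)
    case empty
    \<comment> \<open>Without arcs every walk is a single vertex, so \<open>A \<inter> B\<close>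
      separates and its one-vertex paths form the connector.\<close>
    have "separates {} A B (A \<inter> B)"
      unfolding separates_def
    proof (intro allI impI)
      fix p :: "'a list" assume p: "rwalk {} p \<and> hd p \<in> A \<and> last p \<in> B"
      then obtain a where "p = [a]" by (cases p; cases "tl p") (auto simp: rwalk_def)
      with p show "set p \<inter> (A \<inter> B) \<noteq> {}" by simp
    qed
    with empty have "s \<le> card (A \<inter> B)" by simp
    then obtain I where "I \<subseteq> A \<inter> B" "card I = s" "finite I"
      by (meson obtain_subset_with_card_n)
    then show ?case
      by (intro exI[of _ I] exI[of _ "\<lambda>i. [i]"])
        (auto simp: connector_def rpath_def rwalk_def disjoint_family_on_def)
  next
    case (insert e E)
    obtain x y where e: "e = (x, y)" by force
    have irr: "irrefl E" and xy: "x \<noteq> y" using insert.prems(2) e by (auto simp: irrefl_def)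
    note IH = insert.IH[OF _ irr]
    show ?case
    proof (cases "\<forall>X. finite X \<longrightarrow> separates E A B X \<longrightarrow> s \<le> card X")
      case True
      with IH[OF insert.prems(1)] obtain I :: "'a set" and P
        where I: "card I = s" "finite I" "connector E A B I P" by blast
      have "connector (insert e E) A B I P"
        using I(3) rwalk_mono[of E _ "insert e E"] by (auto simp: connector_def rpath_def)
      with I show ?thesis by blast
    next
      case False
      then obtain S where S: "finite S" "separates E A B S" "card S < s" by (auto simp: not_le)
      \<comment> \<open>A walk without the deleted arc meets \<open>S\<close> and splits there into
        a walk from \<open>A\<close> to \<open>S\<close> and one from \<open>S\<close> to
        \<open>B\<close>; a walk with it yields one from \<open>A\<close> to \<open>x\<close> and
        one from \<open>y\<close> to \<open>B\<close>. Either way \<open>X\<close> meets one of the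
        two parts.\<close>
      have cut: "separates (insert e E) A B X"
        if "separates E A (insert x S) X \<or> separates E (insert y S) B X" for X
        unfolding separates_def
      proof (intro allI impI)
        fix p assume p: "rwalk (insert e E) p \<and> hd p \<in> A \<and> last p \<in> B"
        then have "rwalk (insert (x, y) E) p" by (simp add: e)
        then show "set p \<inter> X \<noteq> {}"
        proof (cases rule: rwalk_insert_cases)
          case 1
          with p S(2) obtain c where c: "c \<in> set p" "c \<in> S" by (auto simp: separates_def)
          then obtain q r where pq: "p = q @ c # r" by (meson split_list)
          have q: "rwalk E (q @ [c])" using 1 pq rwalk_split[of E q c r] by simp
          have r: "rwalk E (c # r)" using 1 pq rwalk_split[of E q c r] by simp
          have "hd (q @ [c]) \<in> A" using p pq by (simp add: hd_append split: if_splits)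
          moreover have "last (c # r) \<in> B" using p pq by simp
          ultimately have "set (q @ [c]) \<inter> X \<noteq> {} \<or> set (c # r) \<inter> X \<noteq> {}"
            using that c(2) q r unfolding separates_def
            by (metis insertCI last_snoc list.sel(1))
          then show ?thesis using pq by auto
        next
          case (2 q r)
          then have "set q \<inter> X \<noteq> {} \<or> set r \<inter> X \<noteq> {}"
            using that p unfolding separates_def by (metis insertI1)
          then show ?thesis using 2 by blast
        qed
      qed
      have self: "separates E C D C" "separates E C D D" for C D
        by (auto simp: separates_def rwalk_def disjoint_iff intro: hd_in_set last_in_set)
      \<comment> \<open>Each of \<open>insert x S\<close> and \<open>insert y S\<close> separates
        itself from the respective side, so \<open>cut\<close> makes it a separator of the full
        relation. As \<open>card S < s\<close>, both have exactly \<open>s\<close> elements.\<close>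
      have "s \<le> card (insert x S)" using insert.prems(3)[OF _ cut] S(1) self by blast
      then have xS: "x \<notin> S" "card (insert x S) = s" using S by (auto simp: card_insert_if split: if_splits)
      have "s \<le> card (insert y S)" using insert.prems(3)[OF _ cut] S(1) self by blast
      then have yS: "y \<notin> S" "card (insert y S) = s" using S by (auto simp: card_insert_if split: if_splits)
      have "\<exists>(I::'a set) P. card I = s \<and> finite I \<and> connector E A (insert x S) I P"
        by (rule IH[OF insert.prems(1)]) (use insert.prems(3) cut in blast)
      then obtain P where P: "connector E A (insert x S) (insert x S) P"
          "\<And>c. c \<in> insert x S \<Longrightarrow> last (P c) = c"
        using connector_by_last xS(2) S(1) by (metis finite_insert)
      have "\<exists>(I::'a set) P. card I = s \<and> finite I \<and> connector E (insert y S) B I P"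
        by (rule IH) (use insert.prems(3) cut S(1) in auto)
      then obtain Q where Q: "connector E (insert y S) B (insert y S) Q"
          "\<And>c. c \<in> insert y S \<Longrightarrow> hd (Q c) = c"
        using connector_by_hd yS(2) S(1) by (metis finite_insert)
      have Pd: "rwalk E (P c)" "distinct (P c)" "hd (P c) \<in> A" if "c \<in> insert x S" for c
        using P(1) that by (auto simp: connector_def rpath_def)
      have Qd: "rwalk E (Q c)" "distinct (Q c)" "last (Q c) \<in> B" if "c \<in> insert y S" for c
        using Q(1) that by (auto simp: connector_def rpath_def)
      have Pdj: "set (P c) \<inter> set (P d) = {}" if "c \<in> insert x S" "d \<in> insert x S" "c \<noteq> d" for c d
        using P(1) that unfolding connector_def disjoint_family_on_def by blast
      have Qdj: "set (Q c) \<inter> set (Q d) = {}" if "c \<in> insert y S" "d \<in> insert y S" "c \<noteq> d" for c d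
        using Q(1) that unfolding connector_def disjoint_family_on_def by blast
      have PS: "c = d" if "c \<in> insert x S" "d \<in> insert x S" "d \<in> set (P c)" for c d
      proof -
        have "d \<in> set (P d)" using P(2)[OF that(2)] Pd(1)[OF that(2)] last_in_set[of "P d"]
          by (simp add: rwalk_def)
        then show ?thesis using Pdj[of c d] that by blast
      qed
      have QS: "c = d" if "c \<in> insert y S" "d \<in> insert y S" "d \<in> set (Q c)" for c d
      proof -
        have "d \<in> set (Q d)" using Q(2)[OF that(2)] Qd(1)[OF that(2)] hd_in_set[of "Q d"]
          by (simp add: rwalk_def)
        then show ?thesis using Qdj[of c d] that by blast
      qed
      \<comment> \<open>Going along \<open>P c\<close> to \<open>v\<close> and on along
        \<open>Q d\<close> gives a walk in \<open>E\<close> from \<open>A\<close> to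
        \<open>B\<close>, which meets \<open>S\<close> in some \<open>a\<close>. A vertex of
        \<open>S\<close> on \<open>P c\<close> can only be its last, one on \<open>Q d\<close> only
        its first, and either forces \<open>v = a\<close>.\<close>
      have meet: "c = v \<and> d = v" if c: "c \<in> insert x S" and d: "d \<in> insert y S"
        and v: "v \<in> set (P c)" "v \<in> set (Q d)" for c d v
      proof -
        from v(1) obtain p1 p2 where p: "P c = p1 @ v # p2" by (meson split_list)
        from v(2) obtain q1 q2 where q: "Q d = q1 @ v # q2" by (meson split_list)
        have w1: "rwalk E (p1 @ [v])" using Pd(1)[OF c] p rwalk_split[of E p1 v p2] by simp
        have w2: "rwalk E (v # q2)" using Qd(1)[OF d] q rwalk_split[of E q1 v q2] by simp
        have "rwalk E ((p1 @ [v]) @ tl (v # q2))" using rwalk_append_tl[OF w1 w2] by simp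
        moreover have "hd (p1 @ v # q2) \<in> A" using Pd(3)[OF c] p by (simp add: hd_append split: if_splits)
        moreover have "last (p1 @ v # q2) \<in> B" using Qd(3)[OF d] q by simp
        ultimately obtain a where a: "a \<in> set (p1 @ v # q2)" "a \<in> S"
          using S(2) unfolding separates_def by fastforce
        have "a \<in> set (p1 @ [v]) \<or> a \<in> set (v # q2)" using a by auto
        then have "v \<in> S"
        proof
          assume h: "a \<in> set (p1 @ [v])"
          then have "c = a" using PS[OF c, of a] a(2) p by auto
          then have "last (P c) = a" using P(2) c by simp
          then have "a \<in> set (v # p2)" using p by (metis last_appendR last_in_set list.distinct(1))
          then have "a = v" using h Pd(2)[OF c] p by auto
          then show ?thesis using a by simp
        next
          assume h: "a \<in> set (v # q2)"
          then have "d = a" using QS[OF d, of a] a(2) q by auto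
          then have "hd (Q d) = a" using Q(2) d by simp
          then have "a \<in> set (q1 @ [v])" using q
            by (metis append_Cons append_Nil append_assoc hd_append hd_in_set list.sel(1) snoc_eq_iff_butlast)
          then have "a = v" using h Qd(2)[OF d] q by auto
          then show ?thesis using a by simp
        qed
        then show ?thesis using PS[OF c, of v] QS[OF d, of v] v by auto
      qed
      \<comment> \<open>The path ending in \<open>x\<close> is joined over the deleted arc to the
        path starting in \<open>y\<close>; for \<open>c\<close> in \<open>S\<close> the two paths
        share \<open>c\<close>, which is kept once.\<close>
      define W where "W = (\<lambda>c. if c = x then P x @ Q y else P c @ tl (Q c))"
      have Wset: "set (W c) = set (P c) \<union> set (Q (if c = x then y else c))"
        if "c \<in> insert x S" for c
        using that Pd(1)[of c] Qd(1)[of c] P(2)[of c] Q(2)[of c]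
        by (auto simp: W_def rwalk_def set_append_tl simp del: set_append)
           (auto)
      have W: "rwalk (insert e E) (W c) \<and> hd (W c) \<in> A \<and> last (W c) \<in> B" if c: "c \<in> insert x S" for c
      proof (cases "c = x")
        case True
        have "rwalk (insert e E) (P x @ Q y)"
          using Pd(1) Qd(1) P(2) Q(2) e
          by (intro rwalk_append rwalk_mono[of E _ "insert e E", OF _ subset_insertI]) auto
        then show ?thesis using True Pd[of x] Qd[of y] by (auto simp: W_def rwalk_def)
      next
        case False
        then have "c \<in> S" using c by simp
        then have "rwalk E (P c @ tl (Q c))"
          using Pd(1) Qd(1) P(2) Q(2) by (intro rwalk_append_tl) auto
        then have "rwalk (insert e E) (P c @ tl (Q c))" by (rule rwalk_mono) auto
        moreover have "last (P c @ tl (Q c)) = last (Q c)"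
          using \<open>c \<in> S\<close> Qd(1)[of c] P(2) Q(2) by (intro last_append_tl) (auto simp: rwalk_def)
        ultimately show ?thesis using False \<open>c \<in> S\<close> Pd[of c] Qd[of c] by (auto simp: W_def rwalk_def)
      qed
      have "disjoint_family_on (\<lambda>i. set (W i)) (insert x S)"
        unfolding disjoint_family_on_def
      proof (intro ballI impI)
        fix c d assume cd: "c \<in> insert x S" "d \<in> insert x S" "c \<noteq> d"
        let ?c = "if c = x then y else c" and ?d = "if d = x then y else d"
        have cd': "?c \<in> insert y S" "?d \<in> insert y S" "?c \<noteq> ?d" using cd yS(1) by auto
        have "set (P c) \<inter> set (P d) = {}" using Pdj cd by blast
        moreover have "set (Q ?c) \<inter> set (Q ?d) = {}" using Qdj cd' by blast
        moreover have "c \<noteq> ?d" "d \<noteq> ?c" using cd xS(1) yS(1) xy by auto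
        then have "set (P c) \<inter> set (Q ?d) = {}" "set (P d) \<inter> set (Q ?c) = {}"
          using meet[OF cd(1) cd'(2)] meet[OF cd(2) cd'(1)] by blast+
        ultimately show "set (W c) \<inter> set (W d) = {}"
          unfolding Wset[OF cd(1)] Wset[OF cd(2)] by blast
      qed
      from connector_from_walks[OF W this] obtain R
        where "connector (insert e E) A B (insert x S) R" .
      then show ?thesis using xS(2) S(1) by blast
    qed
  qed
  then show ?thesis using that by blast
qed

section \<open>Gadgets in tournaments\<close>

text \<open>Values are assigned one index at a time. At each stage fewer than \<open>card I\<close>
  values are taken, so the assumption yields a fresh one.\<close>

lemma greedy_injection:
  assumes "finite I"
    and "\<And>i B. i \<in> I \<Longrightarrow> finite B \<Longrightarrow> card B < card I \<Longrightarrow> \<exists>c. Q i c \<and> c \<notin> B"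
  shows "\<exists>g. inj_on g I \<and> (\<forall>i\<in>I. Q i (g i))"
proof -
  have "\<exists>g. inj_on g J \<and> (\<forall>i\<in>J. Q i (g i))" if "J \<subseteq> I" for J
    using finite_subset[OF that assms(1)] that
  proof (induction J rule: finite_induct)
    case empty
    then show ?case by simp
  next
    case (insert j J)
    then obtain g where g: "inj_on g J" "\<forall>i\<in>J. Q i (g i)" by blast
    have "card (g ` J) < card I"
      using insert assms(1) card_image_le[of J g] card_mono[of I "insert j J"] by simp
    with assms(2)[of j "g ` J"] insert obtain c where c: "Q j c" "c \<notin> g ` J" by auto
    have "inj_on (g(j := c)) (insert j J)" using g(1) c(2) insert(2)
      by (auto simp: inj_on_def)
    moreover have "\<forall>i\<in>insert j J. Q i ((g(j := c)) i)" using g(2) c(1) by simp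
    ultimately show ?case by blast
  qed
  then show ?thesis by blast
qed

lemma injective_choice:
  assumes "finite I" "\<And>i. i \<in> I \<Longrightarrow> finite (C i) \<and> card I \<le> card (C i)"
  obtains g where "inj_on g I" "\<And>i. i \<in> I \<Longrightarrow> g i \<in> C i"
proof -
  have "\<exists>c. c \<in> C i \<and> c \<notin> B" if "i \<in> I" "finite B" "card B < card I" for i B
  proof (rule ccontr)
    assume "\<not> ?thesis"
    then have "card (C i) \<le> card B" using that by (intro card_mono) auto
    then show False using assms(2) that by force
  qed
  then show ?thesis using greedy_injection[of I "\<lambda>i c. c \<in> C i"] assms(1) that by blast
qed

lemma lowest_subset:
  fixes f :: "'a \<Rightarrow> nat"
  assumes "finite H" "n \<le> card H"
  obtains V where "V \<subseteq> H" "card V = n" "\<And>v z. v \<in> V \<Longrightarrow> z \<in> H - V \<Longrightarrow> f v \<le> f z"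
proof -
  have "\<exists>V\<subseteq>H. card V = n \<and> (\<forall>v\<in>V. \<forall>z\<in>H - V. f v \<le> f z)"
    using assms(2)
  proof (induction n)
    case 0
    then show ?case by (intro exI[of _ "{}"]) simp
  next
    case (Suc n)
    then obtain V where V: "V \<subseteq> H" "card V = n" "\<forall>v\<in>V. \<forall>z\<in>H - V. f v \<le> f z" by auto
    have "card (H - V) = card H - n" using V assms(1) by (simp add: card_Diff_subset finite_subset)
    then have "card (H - V) \<noteq> 0" using Suc.prems by linarith
    then have "H - V \<noteq> {}" by (metis card.empty)
    then obtain w where w: "w \<in> H - V" "\<forall>z\<in>H - V. f w \<le> f z"
      using assms(1) ex_min_if_finite[of "f ` (H - V)"] arg_min_if_finite[of "H - V" f]
      by (metis finite_Diff not_le)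
    have "card (insert w V) = Suc n" using V w assms(1) by (simp add: finite_subset)
    then show ?case using V w by (intro exI[of _ "insert w V"]) auto
  qed
  then show ?thesis using that by blast
qed

section \<open>Finite tournaments as relations\<close>

locale finite_tournament =
  fixes W :: "'a set" and E :: "('a \<times> 'a) set"
  assumes fin: "finite W"
    and arcs: "E \<subseteq> W \<times> W"
    and irr: "(u, u) \<notin> E"
    and total: "u \<in> W \<Longrightarrow> v \<in> W \<Longrightarrow> u \<noteq> v \<Longrightarrow> (u, v) \<in> E \<or> (v, u) \<in> E"
    and asym: "(u, v) \<in> E \<Longrightarrow> (v, u) \<notin> E"
begin

lemma rwalk_in_vertices: "rwalk E p \<Longrightarrow> hd p \<in> W \<Longrightarrow> set p \<subseteq> W"
proof (induction p)
  case (Cons a p)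
  then show ?case using arcs by (cases p) (auto simp: rwalk_def)
qed simp

definition out :: "'a \<Rightarrow> 'a set \<Rightarrow> 'a set" where
  "out v S = {z \<in> S. (v, z) \<in> E}"

lemma out_subset: "out v S \<subseteq> S"
  by (auto simp: out_def)

lemma finite_out: "S \<subseteq> W \<Longrightarrow> finite (out v S)"
  using fin finite_subset[of S W] by (simp add: out_def)

lemma out_degree_in_out_neighbours_sum:
  assumes Q: "Q \<subseteq> W" "v \<in> Q"
  shows "card (out v Q) + card {z \<in> Q. (z, v) \<in> E} + 1 = card Q"
proof -
  have f: "finite Q" using Q fin finite_subset by blast
  have "Q = insert v (out v Q \<union> {z \<in> Q. (z, v) \<in> E})"
    using Q total by (auto simp: out_def subset_iff)
  moreover have "card (insert v (out v Q \<union> {z \<in> Q. (z, v) \<in> E})) =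
      card (out v Q) + card {z \<in> Q. (z, v) \<in> E} + 1"
    using f irr asym by (subst card_insert_disjoint; (subst card_Un_disjoint)?) (auto simp: out_def)
  ultimately show ?thesis by simp
qed

text \<open>Out-degrees and in-degrees within \<open>Q\<close> have the same sum, and at each vertex
  the two add up to \<open>card Q - 1\<close>, so the average out-degree is half of that.\<close>

lemma exists_low_out_degree:
  assumes Q: "Q \<subseteq> W" "Q \<noteq> {}"
  obtains b where "b \<in> Q" "2 * card (out b Q) + 1 \<le> card Q"
proof -
  have f: "finite Q" using Q fin finite_subset by blast
  have c: "card {z \<in> Q. R z} = (\<Sum>z\<in>Q. if R z then 1 else 0)" for R
    using f by (simp add: sum.If_cases Int_def conj_commute)
  have eq: "(\<Sum>v\<in>Q. card (out v Q)) = (\<Sum>v\<in>Q. card {z \<in> Q. (z, v) \<in> E})"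
    unfolding out_def c by (subst sum.swap) simp
  have "(\<Sum>v\<in>Q. card (out v Q) + card {z \<in> Q. (z, v) \<in> E} + 1) = (\<Sum>v\<in>Q. card Q)"
    using out_degree_in_out_neighbours_sum[OF Q(1)] by (intro sum.cong) auto
  then have "(\<Sum>v\<in>Q. 2 * card (out v Q) + 1) = (\<Sum>v\<in>Q. card Q)"
    using eq by (simp add: sum.distrib sum_Suc sum_distrib_left[symmetric])
  then have "\<not> (\<forall>v\<in>Q. card Q < 2 * card (out v Q) + 1)"
    using sum_strict_mono[of Q "\<lambda>_. card Q" "\<lambda>v. 2 * card (out v Q) + 1"] f Q(2) by auto
  then show ?thesis using that by (meson not_le)
qed

text \<open>Halving twice: \<open>b\<close> has low out-degree in \<open>Q\<close>, and
  \<open>c\<close> has low out-degree within the out-neighbourhood of \<open>b\<close>.\<close>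

lemma exists_quarter_pair:
  assumes Q: "Q \<subseteq> W" "2 \<le> card Q"
  obtains b c where "b \<in> Q" "c \<in> Q" "(b, c) \<in> E" "4 * card (out b Q \<inter> out c Q) \<le> card Q"
proof -
  have "Q \<noteq> {}" using Q by auto
  then obtain b where b: "b \<in> Q" "2 * card (out b Q) + 1 \<le> card Q"
    using exists_low_out_degree[OF Q(1)] by blast
  show ?thesis
  proof (cases "out b Q = {}")
    case True
    have "\<not> Q \<subseteq> {b}" using Q(2) card_mono[of "{b}" Q] by auto
    then obtain c where c: "c \<in> Q" "c \<noteq> b" by auto
    \<comment> \<open>Here \<open>b\<close> is a sink of \<open>Q\<close>, so the pair is taken in
      the order \<open>c\<close>, \<open>b\<close> and has no common out-neighbour in
      \<open>Q\<close>.\<close>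
    then have "(c, b) \<in> E" using True total[of b c] b Q(1) by (auto simp: out_def)
    then show ?thesis using that[of c b] b c True by simp
  next
    case False
    have "out b Q \<subseteq> W" using Q(1) out_subset by blast
    with False obtain c where c: "c \<in> out b Q" "2 * card (out c (out b Q)) + 1 \<le> card (out b Q)"
      using exists_low_out_degree by blast
    moreover have "out b Q \<inter> out c Q = out c (out b Q)" by (auto simp: out_def)
    ultimately show ?thesis using that[of b c] b by (simp add: out_def)
  qed
qed

text \<open>Gadgets are built one at a time by applying \<open>exists_quarter_pair\<close> to the
  out-neighbours still free. The sets bounded for earlier gadgets only shrink as later ones are
  added.\<close>

lemma exists_gadgets:
  assumes H: "H \<subseteq> W" and V: "V \<subseteq> H"
    and deg: "\<And>v. v \<in> V \<Longrightarrow> 3 * card V \<le> card (out v H)"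
  obtains b u where "inj_on b V" "inj_on u V" "b ` V \<inter> u ` V = {}"
    "b ` V \<subseteq> H - V" "u ` V \<subseteq> H - V"
    "\<forall>v\<in>V. (v, b v) \<in> E \<and> (v, u v) \<in> E \<and> (b v, u v) \<in> E"
    "\<forall>v\<in>V.
      4 * card {z \<in> H - V - b ` V - u ` V. (v, z) \<in> E \<and> (b v, z) \<in> E \<and> (u v, z) \<in> E}
        \<le> card (out v H)"
proof -
  have fH: "finite H" using H fin by (rule finite_subset)
  have fV: "finite V" using V fH by (rule finite_subset)
  define good where "good = (\<lambda>U b u. inj_on b U \<and> inj_on u U \<and> b ` U \<inter> u ` U = {} \<and>
    b ` U \<subseteq> H - V \<and> u ` U \<subseteq> H - V \<and>
    (\<forall>v\<in>U. (v, b v) \<in> E \<and> (v, u v) \<in> E \<and> (b v, u v) \<in> E) \<and>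
    (\<forall>v\<in>U. 4 * card {z \<in> H - V - b ` U - u ` U. (v, z) \<in> E \<and> (b v, z) \<in> E \<and> (u v, z) \<in> E}
        \<le> card (out v H)))"
  have "\<exists>b u. good U b u" if "U \<subseteq> V" for U
    using finite_subset[OF that fV] that
  proof (induction U rule: finite_induct)
    case empty
    then show ?case by (simp add: good_def)
  next
    case (insert w U)
    then obtain b u where bu: "good U b u" by auto
    define Q where "Q = out w (H - V - b ` U - u ` U)"
    have QW: "Q \<subseteq> W" "Q \<subseteq> H - V - b ` U - u ` U" using H out_subset[of w] by (auto simp: Q_def)
    have wV: "w \<in> V" "card U < card V"
      using insert fV psubset_card_mono[of V U] by auto
    \<comment> \<open>The vertices lost are those of \<open>V\<close> other than \<open>w\<close>
      and the values of \<open>b\<close> and \<open>u\<close> chosen so far, at most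
      \<open>3 * (card V - 1)\<close> in all.\<close>
    have "out w H \<subseteq> Q \<union> (V - {w}) \<union> b ` U \<union> u ` U"
      using irr by (auto simp: Q_def out_def)
    then have "card (out w H) \<le> card (Q \<union> (V - {w}) \<union> b ` U \<union> u ` U)"
      using finite_out[of "H - V - b ` U - u ` U" w] H fV insert(1)
      by (intro card_mono) (auto simp: Q_def)
    also have "\<dots> \<le> card Q + card (V - {w}) + card (b ` U) + card (u ` U)"
      by (meson card_Un_le order_trans add_mono order_refl)
    also have "\<dots> \<le> card Q + (card V - 1) + card U + card U"
      using card_image_le[OF insert(1)] wV fV by (intro add_mono) auto
    finally have "2 \<le> card Q" using deg[OF wV(1)] wV(2) by linarith
    then obtain c d where cd: "c \<in> Q" "d \<in> Q" "(c, d) \<in> E" "4 * card (out c Q \<inter> out d Q) \<le> card Q"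
      using exists_quarter_pair[OF QW(1)] by blast
    let ?b = "b(w := c)" and ?u = "u(w := d)"
    have im: "?b ` insert w U = insert c (b ` U)" "?u ` insert w U = insert d (u ` U)"
      using insert(2) by auto
    have cdn: "c \<noteq> d" using cd(3) irr by auto
    have cH: "c \<in> H - V - b ` U - u ` U" "d \<in> H - V - b ` U - u ` U" using cd QW by auto
    have 1: "inj_on ?b (insert w U)" "inj_on ?u (insert w U)"
      using bu cH insert(2) unfolding good_def inj_on_def by auto
    have 2: "insert c (b ` U) \<inter> insert d (u ` U) = {}" using bu cH cdn by (auto simp: good_def)
    have 3: "insert c (b ` U) \<subseteq> H - V" "insert d (u ` U) \<subseteq> H - V" using bu cH by (auto simp: good_def)
    have 4: "\<forall>v\<in>insert w U. (v, ?b v) \<in> E \<and> (v, ?u v) \<in> E \<and> (?b v, ?u v) \<in> E"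
      using bu cd insert(2) by (auto simp: good_def Q_def out_def)
    have 5: "4 * card {z \<in> H - V - insert c (b ` U) - insert d (u ` U).
          (v, z) \<in> E \<and> (?b v, z) \<in> E \<and> (?u v, z) \<in> E} \<le> card (out v H)" (is "4 * card (?S v) \<le> _")
      if "v \<in> insert w U" for v
    proof (cases "v = w")
      case True
      have "card (?S w) \<le> card (out c Q \<inter> out d Q)"
        using finite_out[OF QW(1)] by (intro card_mono) (auto simp: Q_def out_def)
      moreover have "card Q \<le> card (out w H)"
        using finite_out[OF H] by (intro card_mono) (auto simp: Q_def out_def)
      ultimately show ?thesis using cd(4) True by simp
    next
      case False
      then have "v \<in> U" using that by simp
      have "card (?S v) \<le> card {z \<in> H - V - b ` U - u ` U. (v, z) \<in> E \<and> (b v, z) \<in> E \<and> (u v, z) \<in> E}"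
        using fH False by (intro card_mono) auto
      then show ?thesis using bu \<open>v \<in> U\<close> unfolding good_def by (meson le_trans mult_le_mono2)
    qed
    have "good (insert w U) ?b ?u"
      unfolding good_def im using 1 2 3 4 5 by blast
    then show ?case by blast
  qed
  from this[OF order_refl] obtain b u where "good V b u" by blast
  then show ?thesis using that[of b u] unfolding good_def by blast
qed

end

section \<open>Counting in a system of gadgets\<close>

lemma landing_count:
  fixes D w k :: int
  assumes "2 \<le> k" "0 \<le> w" "19 * k - 14 \<le> D"
  shows "(3 * k - 1 - w) * D < 4 * k * (D - 3 * w - (2 * k - 1))"
proof -
  \<comment> \<open>The right side of the goal exceeds the left by
    \<open>D * (k + 1 + w) - 12 * k * w - 8 * k * k + 4 * k\<close>. With \<open>19 * k - 14\<close>
    in place of \<open>D\<close> this is \<open>11 * k * k + 9 * k - 14 + w * (7 * k - 14)\<close>,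
    which is positive because \<open>k\<close> is at least 2.\<close>
  have "(19 * k - 14) * (k + 1 + w) \<le> D * (k + 1 + w)"
    using assms by (intro mult_right_mono) auto
  moreover have "0 \<le> w * (7 * k - 14)" using assms by simp
  moreover have "2 * 2 \<le> k * k" using assms by (intro mult_mono) auto
  ultimately show ?thesis using assms(1) by (simp add: algebra_simps)
qed

text \<open>The size \<open>3 * k - 1\<close> of \<open>V\<close> is chosen so that missing fewer
  than \<open>k\<close> gadgets means entering at least \<open>2 * k\<close>: at most
  \<open>k\<close> of these start paths to the sinks, and \<open>k\<close> remain to choose distinct
  ones from. The bound in \<open>deg_H\<close> is \<open>21 * k - 14\<close> less the
  \<open>2 * k\<close> terminals.\<close>

locale gadget_system = finite_tournament W E for W :: "'a set" and E +
  fixes k :: nat and H V :: "'a set" and b u :: "'a \<Rightarrow> 'a"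
  assumes k2: "2 \<le> k"
    and HW: "H \<subseteq> W" and VH: "V \<subseteq> H" and cardV: "card V = 3 * k - 1"
    and low: "v \<in> V \<Longrightarrow> z \<in> H - V \<Longrightarrow> card (out v H) \<le> card (out z H)"
    and deg_H: "z \<in> H \<Longrightarrow> 19 * k \<le> card (out z H) + 14"
    and inj_b: "inj_on b V" and inj_u: "inj_on u V"
    and b_u_disjoint: "b ` V \<inter> u ` V = {}"
    and bV: "b ` V \<subseteq> H - V" and uV: "u ` V \<subseteq> H - V"
    and gadget_arcs: "v \<in> V \<Longrightarrow> (v, b v) \<in> E \<and> (v, u v) \<in> E \<and> (b v, u v) \<in> E"
    and few_dominated: "v \<in> V \<Longrightarrow>
      4 * card {z \<in> H - V - b ` V - u ` V. (v, z) \<in> E \<and> (b v, z) \<in> E \<and> (u v, z) \<in> E}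
        \<le> card (out v H)"
begin

definition Z :: "'a set" where "Z = V \<union> b ` V \<union> u ` V"

definition R :: "'a set" where "R = H - Z"

definition hits :: "'a \<Rightarrow> 'a \<Rightarrow> bool" where
  "hits z v \<longleftrightarrow> (z, v) \<in> E \<or> (z, b v) \<in> E \<or> (z, u v) \<in> E"

text \<open>The vertices strictly between \<open>z\<close> and the exit \<open>u v\<close>. At most
  one is needed, since \<open>v\<close> and \<open>b v\<close> both have an arc to
  \<open>u v\<close>; the last branch is meant for a \<open>z\<close> that hits the gadget.\<close>

definition route :: "'a \<Rightarrow> 'a \<Rightarrow> 'a list" where
  "route z v = (if (z, u v) \<in> E then [] else if (z, v) \<in> E then [v] else [b v])"

lemma set_route: "set (route z v) \<subseteq> {v, b v}"
  by (auto simp: route_def)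

lemma rwalk_route: "v \<in> V \<Longrightarrow> hits z v \<Longrightarrow> rwalk E (z # route z v @ [u v])"
  using gadget_arcs[of v] by (auto simp: route_def hits_def rwalk_def)

lemma finite_sets: "finite H" "finite V" "finite Z" "finite R"
proof -
  show "finite H" using HW fin by (rule finite_subset)
  show "finite V" using VH \<open>finite H\<close> by (rule finite_subset)
  then show "finite Z" by (simp add: Z_def)
  show "finite R" using \<open>finite H\<close> by (simp add: R_def)
qed

lemma card_gadgets: "J \<subseteq> V \<Longrightarrow> card (\<Union>v\<in>J. {v, b v, u v}) \<le> 3 * card J"
proof -
  assume "J \<subseteq> V"
  then have "finite J" using finite_sets(2) finite_subset by blast
  then have "card (\<Union>v\<in>J. {v, b v, u v}) \<le> (\<Sum>v\<in>J. card {v, b v, u v})"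
    by (rule card_UN_le)
  also have "\<dots> \<le> (\<Sum>v\<in>J. 3)" by (intro sum_mono) (simp add: card_insert_if)
  finally show ?thesis by simp
qed

lemma Z_eq: "Z = (\<Union>v\<in>V. {v, b v, u v})"
  by (auto simp: Z_def)

lemma card_Z: "card Z \<le> 9 * k - 3"
  using card_gadgets[of V] cardV by (simp add: Z_eq)

lemma gadget_in_H: "v \<in> V \<Longrightarrow> v \<in> H \<and> b v \<in> H \<and> u v \<in> H"
  using VH bV uV by auto

lemma misses_dominated:
  assumes "v \<in> V" "z \<in> R" "\<not> hits z v"
  shows "(v, z) \<in> E" "(b v, z) \<in> E" "(u v, z) \<in> E"
proof -
  have z: "z \<in> W" "z \<notin> Z" using assms(2) HW by (auto simp: R_def)
  have w: "v \<in> W" "b v \<in> W" "u v \<in> W" using gadget_in_H[OF assms(1)] HW by auto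
  have ne: "z \<noteq> v" "z \<noteq> b v" "z \<noteq> u v" using z(2) assms(1) by (auto simp: Z_def)
  show "(v, z) \<in> E" "(b v, z) \<in> E" "(u v, z) \<in> E"
    using total[OF z(1) w(1) ne(1)] total[OF z(1) w(2) ne(2)] total[OF z(1) w(3) ne(3)] assms(3)
    by (auto simp: hits_def)
qed

text \<open>By totality, a vertex of \<open>R\<close> with no arc into the gadget is dominated by
  all three of its vertices.\<close>

lemma few_misses:
  assumes "v \<in> V"
  shows "4 * card {z \<in> R. \<not> hits z v} \<le> card (out v H)"
proof -
  have "card {z \<in> R. \<not> hits z v} \<le>
      card {z \<in> H - V - b ` V - u ` V. (v, z) \<in> E \<and> (b v, z) \<in> E \<and> (u v, z) \<in> E}"
  proof (intro card_mono subsetI)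
    fix z assume "z \<in> {z \<in> R. \<not> hits z v}"
    then show "z \<in> {z \<in> H - V - b ` V - u ` V. (v, z) \<in> E \<and> (b v, z) \<in> E \<and> (u v, z) \<in> E}"
      using misses_dominated[OF assms, of z] by (simp add: R_def Z_def)
  qed (use finite_sets in simp)
  then show ?thesis using few_dominated[OF assms] by linarith
qed

text \<open>Averaging over the out-neighbours of \<open>z\<close>: if \<open>z\<close> itself hits few gadgets, then most of them lie
  in \<open>R\<close>, where every gadget is missed by at most a quarter.\<close>

lemma exists_landing:
  assumes z: "z \<in> R" and B: "finite B" "card B < 2 * k"
  obtains c where "(z, c) \<in> E" "c \<in> R" "c \<notin> B" "card {v \<in> V. \<not> hits z v \<and> \<not> hits c v} < k"
proof (rule ccontr)
  assume "\<not> thesis"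
  then have no: "k \<le> card {v \<in> V. \<not> hits z v \<and> \<not> hits c v}"
    if "(z, c) \<in> E" "c \<in> R" "c \<notin> B" for c
    using that \<open>\<And>c. (z, c) \<in> E \<Longrightarrow> c \<in> R \<Longrightarrow> c \<notin> B \<Longrightarrow>
      card {v \<in> V. \<not> hits z v \<and> \<not> hits c v} < k \<Longrightarrow> thesis\<close>
    by (meson not_le)
  define J where "J = {v \<in> V. hits z v}"
  define M where "M = {v \<in> V. \<not> hits z v}"
  define A where "A = out z R - B"
  define D where "D = card (out z H)"
  have fin': "finite J" "finite M" "finite A"
    using finite_sets finite_out[of R z] HW by (auto simp: J_def M_def A_def R_def)
  have zH: "z \<in> H - V" using z by (auto simp: R_def Z_def)
  have JM: "card J + card M = 3 * k - 1"
  proof -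
    have "V = J \<union> M" "J \<inter> M = {}" by (auto simp: J_def M_def)
    then show ?thesis using card_Un_disjoint[OF fin'(1,2)] cardV by simp
  qed
  \<comment> \<open>An out-neighbour of \<open>z\<close> inside \<open>Z\<close> lies in a gadget
    that \<open>z\<close> hits, and each such gadget has at most three vertices.\<close>
  have "out z H \<subseteq> A \<union> B \<union> (\<Union>v\<in>J. {v, b v, u v})"
    by (auto simp: out_def A_def R_def Z_eq J_def hits_def)
  then have "D \<le> card (A \<union> B \<union> (\<Union>v\<in>J. {v, b v, u v}))"
    unfolding D_def using fin' B by (intro card_mono) auto
  also have "\<dots> \<le> card A + card B + card (\<Union>v\<in>J. {v, b v, u v})"
    by (meson card_Un_le order_trans add_mono order_refl)
  also have "\<dots> \<le> card A + (2 * k - 1) + 3 * card J"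
    using card_gadgets[of J] B by (intro add_mono) (auto simp: J_def)
  finally have DA: "int D - 3 * int (card J) - (2 * int k - 1) \<le> int (card A)"
    using k2 by linarith
  have c: "card {v \<in> S. Q v} = (\<Sum>v\<in>S. if Q v then 1 else 0)" if "finite S" for S :: "'a set" and Q
    using that by (simp add: sum.If_cases Int_def conj_commute)
  \<comment> \<open>Double counting of the pairs in which \<open>c\<close> from \<open>A\<close>
    misses \<open>v\<close> from \<open>M\<close>. Each \<open>c\<close> misses at least
    \<open>k\<close> such gadgets by \<open>no\<close>; each \<open>v\<close> is missed by at most
    \<open>D / 4\<close> vertices, since \<open>v\<close> belongs to the vertices of lowest
    out-degree and \<open>z\<close> does not.\<close>
  have "k * card A = (\<Sum>c\<in>A. k)" by simp
  also have "\<dots> \<le> (\<Sum>c\<in>A. card {v \<in> M. \<not> hits c v})"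
    using no by (intro sum_mono) (auto simp: A_def out_def M_def conj_assoc)
  also have "\<dots> = (\<Sum>v\<in>M. card {c \<in> A. \<not> hits c v})"
    unfolding c[OF fin'(2)] c[OF fin'(3)] by (rule sum.swap)
  finally have "4 * (k * card A) \<le> 4 * (\<Sum>v\<in>M. card {c \<in> A. \<not> hits c v})"
    by (rule mult_le_mono2)
  also have "\<dots> = (\<Sum>v\<in>M. 4 * card {c \<in> A. \<not> hits c v})"
    by (rule sum_distrib_left)
  also have "\<dots> \<le> (\<Sum>v\<in>M. D)"
  proof (rule sum_mono)
    fix v assume v: "v \<in> M"
    then have vV: "v \<in> V" by (simp add: M_def)
    have "card {c \<in> A. \<not> hits c v} \<le> card {c \<in> R. \<not> hits c v}"
      using finite_sets by (intro card_mono) (auto simp: A_def out_def)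
    then show "4 * card {c \<in> A. \<not> hits c v} \<le> D"
      using few_misses[OF vV] low[OF vV zH] by (simp add: D_def)
  qed
  finally have "4 * (k * card A) \<le> card M * D" by simp
  then have "int (4 * (k * card A)) \<le> int (card M * D)" by (rule of_nat_mono)
  moreover have "int (card M) = 3 * int k - 1 - int (card J)" using JM k2 by linarith
  ultimately have "4 * int k * int (card A) \<le> (3 * int k - 1 - int (card J)) * int D"
    by (simp add: mult.assoc)
  moreover have "4 * int k * (int D - 3 * int (card J) - (2 * int k - 1)) \<le> 4 * int k * int (card A)"
    using DA by (intro mult_left_mono) auto
  moreover have "19 * int k - 14 \<le> int D" using deg_H[of z] zH by (simp add: D_def)
  ultimately show False using landing_count[of "int k" "int (card J)" "int D"] k2 by linarith
qed

text \<open>Provides the vertex leading from an exit to a gadget it does not hit. Neither gadget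
  \<open>m\<close> nor gadget \<open>v\<close> contains out-neighbours of \<open>u m\<close>: the
  first because \<open>m\<close> and \<open>b m\<close> dominate \<open>u m\<close>, the second by
  assumption. Of the out-degree \<open>D\<close>, at most \<open>9 * k - 9\<close> is lost to other
  gadgets, \<open>3 * k\<close> to \<open>B\<close> and \<open>D / 4\<close> to vertices missing
  \<open>v\<close>.\<close>

lemma many_links:
  assumes mv: "m \<in> V" "v \<in> V" "m \<noteq> v" "\<not> hits (u m) v" and B: "finite B" "card B \<le> 3 * k"
  shows "k \<le> card {q \<in> R - B. (u m, q) \<in> E \<and> hits q v}" (is "_ \<le> card ?C")
proof -
  define D where "D = card (out (u m) H)"
  let ?N = "{z \<in> R. \<not> hits z v}" and ?G = "\<Union>w\<in>V - {m, v}. {w, b w, u w}"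
  have um: "u m \<in> H - V" using uV mv by blast
  have cV: "card (V - {m, v}) = 3 * k - 3"
    using mv finite_sets cardV by (simp add: card_Diff_subset)
  have "out (u m) H \<subseteq> ?C \<union> ?N \<union> B \<union> ?G"
  proof
    fix q assume q: "q \<in> out (u m) H"
    show "q \<in> ?C \<union> ?N \<union> B \<union> ?G"
    proof (cases "q \<in> Z")
      case True
      then obtain w where w: "w \<in> V" "q \<in> {w, b w, u w}" by (auto simp: Z_eq)
      have "w \<noteq> m" using q w gadget_arcs[OF mv(1)] asym irr by (auto simp: out_def)
      moreover have "w \<noteq> v" using q w mv(4) by (auto simp: out_def hits_def)
      ultimately show ?thesis using w by blast
    next
      case False
      then show ?thesis using q by (auto simp: out_def R_def)
    qed
  qed
  then have "D \<le> card (?C \<union> ?N \<union> B \<union> ?G)"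
    unfolding D_def using finite_sets B by (intro card_mono) auto
  also have "\<dots> \<le> card ?C + card ?N + card B + card ?G"
    by (meson card_Un_le order_trans add_mono order_refl)
  also have "\<dots> \<le> card ?C + card ?N + 3 * k + 3 * (3 * k - 3)"
    using card_gadgets[of "V - {m, v}"] cV B by (intro add_mono) auto
  finally have "D \<le> card ?C + card ?N + 3 * k + 3 * (3 * k - 3)" .
  moreover have "4 * card ?N \<le> D" using few_misses[OF mv(2)] low[OF mv(2) um] by (simp add: D_def)
  moreover have "19 * k \<le> D + 14" using deg_H[of "u m"] um by (simp add: D_def)
  ultimately show ?thesis using k2 by linarith
qed

end

section \<open>Linkings of minimal total length\<close>

text \<open>Each path has its own prescribed end, but its start is free within \<open>U\<close>, so
  it may be exchanged for a path with another start.\<close>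

definition linking :: "('a \<times> 'a) set \<Rightarrow> 'a set \<Rightarrow> ('i \<Rightarrow> 'a) \<Rightarrow> 'i set \<Rightarrow> ('i \<Rightarrow> 'a list) \<Rightarrow> bool" where
  "linking F U y I P \<longleftrightarrow>
    (\<forall>i\<in>I. rpath F U {y i} (P i)) \<and> disjoint_family_on (\<lambda>i. set (P i)) I"

text \<open>Replacing the single path \<open>P i\<close> by \<open>p\<close> gives another linking,
  whose total length differs only in that summand.\<close>

lemma linking_exchange:
  assumes "finite I" "linking F U y I P"
    and min: "\<And>P'. linking F U y I P' \<Longrightarrow> (\<Sum>i\<in>I. length (P i)) \<le> (\<Sum>i\<in>I. length (P' i))"
    and i: "i \<in> I" "rpath F U {y i} p" "\<And>j. j \<in> I \<Longrightarrow> j \<noteq> i \<Longrightarrow> set p \<inter> set (P j) = {}"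
  shows "length (P i) \<le> length p"
proof -
  have "linking F U y I (P(i := p))"
    using assms(2) i unfolding linking_def disjoint_family_on_def by auto
  note le = min[OF this]
  have "(\<Sum>j\<in>I - {i}. length ((P(i := p)) j)) = (\<Sum>j\<in>I - {i}. length (P j))"
    by (intro sum.cong) auto
  then show ?thesis using le by (simp add: sum.remove[OF assms(1) i(1)])
qed

lemma rpath_suffix:
  "rpath F U B (p @ q) \<Longrightarrow> q \<noteq> [] \<Longrightarrow> hd q \<in> U \<Longrightarrow> rpath F U B q"
  by (auto simp: rpath_def rwalk_def successively_append_iff)

text \<open>A later vertex of \<open>U\<close> on \<open>P i\<close> would start a proper suffix
  that could replace \<open>P i\<close>.\<close>

lemma minimal_linking_start:
  assumes "finite I" "linking F U y I P"
    and min: "\<And>P'. linking F U y I P' \<Longrightarrow> (\<Sum>i\<in>I. length (P i)) \<le> (\<Sum>i\<in>I. length (P' i))"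
    and i: "i \<in> I"
  shows "set (P i) \<inter> U = {hd (P i)}"
proof -
  have Pi: "rpath F U {y i} (P i)" using assms(2) i by (simp add: linking_def)
  have "a = hd (P i)" if a: "a \<in> set (P i)" "a \<in> U" for a
  proof -
    from a(1) obtain p q where p: "P i = p @ a # q" by (meson split_list)
    have "rpath F U {y i} (a # q)" using rpath_suffix[of F U "{y i}" p "a # q"] Pi p a by simp
    moreover have "set (a # q) \<inter> set (P j) = {}" if "j \<in> I" "j \<noteq> i" for j
    proof -
      have "set (P i) \<inter> set (P j) = {}"
        using assms(2) i that by (auto simp: linking_def disjoint_family_on_def)
      then show ?thesis unfolding p by auto
    qed
    ultimately have "length (P i) \<le> length (a # q)"
      using linking_exchange[OF assms(1,2) min i] by blast
    then show ?thesis using p by simp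
  qed
  moreover have "hd (P i) \<in> set (P i)" "hd (P i) \<in> U"
    using Pi by (auto simp: rpath_def rwalk_def)
  ultimately show ?thesis by blast
qed

text \<open>Otherwise \<open>f\<close> followed by the tail from \<open>q\<close> would be a shorter replacement for \<open>P i\<close>.\<close>

lemma minimal_linking_unused_start:
  assumes "finite I" "linking F U y I P"
    and min: "\<And>P'. linking F U y I P' \<Longrightarrow> (\<Sum>i\<in>I. length (P i)) \<le> (\<Sum>i\<in>I. length (P' i))"
    and i: "i \<in> I" and f: "f \<in> U" "\<And>j. j \<in> I \<Longrightarrow> f \<notin> set (P j)"
    and q: "q \<in> set (P i)" "(f, q) \<in> F"
  shows "q = P i ! 0 \<or> q = P i ! 1"
proof -
  have Pi: "rpath F U {y i} (P i)" using assms(2) i by (simp add: linking_def)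
  from q(1) obtain p r where p: "P i = p @ q # r" by (meson split_list)
  have "rpath F U {y i} (f # q # r)"
    using Pi f(1) f(2)[OF i] q(2) p by (auto simp: rpath_def rwalk_def successively_append_iff)
  moreover have "set (f # q # r) \<inter> set (P j) = {}" if "j \<in> I" "j \<noteq> i" for j
  proof -
    have "set (P i) \<inter> set (P j) = {}"
      using assms(2) i that by (auto simp: linking_def disjoint_family_on_def)
    then show ?thesis using f(2)[OF that(1)] unfolding p by auto
  qed
  ultimately have "length (P i) \<le> length (f # q # r)"
    using linking_exchange[OF assms(1,2) min i] by blast
  then have "length p \<le> 1" using p by simp
  then show ?thesis using p by (cases p) auto
qed

lemma rwalk_restrict: "rwalk E p \<Longrightarrow> set p \<subseteq> G \<Longrightarrow> rwalk (E \<inter> G \<times> G) p"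
proof (induction p)
  case (Cons a p)
  then show ?case by (cases p) (auto simp: rwalk_def)
qed (simp add: rwalk_def)

lemma rwalk_restricted_vertices: "rwalk (E \<inter> G \<times> G) p \<Longrightarrow> hd p \<in> G \<Longrightarrow> set p \<subseteq> G"
proof (induction p)
  case (Cons a p)
  then show ?case by (cases p) (auto simp: rwalk_def)
qed (simp add: rwalk_def)

text \<open>With \<open>S\<close> reserved, a separator smaller than \<open>card I\<close> would
  together with \<open>S\<close> have fewer than \<open>m\<close> vertices and contradict the
  connectivity. Menger's theorem then yields a linking, and one of least total length is
  taken.\<close>

lemma (in finite_tournament) exists_minimal_linking:
  assumes conn: "\<And>S a c. S \<subseteq> W \<Longrightarrow> card S < m \<Longrightarrow> a \<in> W - S \<Longrightarrow> c \<in> W - S \<Longrightarrow>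
      \<exists>p. rwalk E p \<and> set p \<subseteq> W - S \<and> hd p = a \<and> last p = c"
    and S: "S \<subseteq> W" "card S + card I \<le> m"
    and I: "finite I"
    and U: "U \<subseteq> W - S" "card I \<le> card U"
    and y: "y ` I \<subseteq> W - S" "inj_on y I"
  shows "\<exists>P. linking (E \<inter> (W - S) \<times> (W - S)) U y I P \<and>
    (\<forall>P'. linking (E \<inter> (W - S) \<times> (W - S)) U y I P' \<longrightarrow>
      (\<Sum>i\<in>I. length (P i)) \<le> (\<Sum>i\<in>I. length (P' i)))"
proof -
  let ?F = "E \<inter> (W - S) \<times> (W - S)"
  have cy: "card (y ` I) = card I" using y(2) by (rule card_image)
  have fU: "finite U" using U(1) fin by (meson finite_Diff finite_subset)
  have "finite ?F" using fin by simp
  moreover have "irrefl ?F" using irr by (auto simp: irrefl_def)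
  moreover have "card I \<le> card X" if X: "finite X" "separates ?F U (y ` I) X" for X
  proof (rule ccontr)
    assume "\<not> ?thesis"
    then have lt: "card X < card I" by simp
    have "\<not> U \<subseteq> X" using card_mono[OF X(1), of U] lt U(2) by linarith
    then obtain a where a: "a \<in> U" "a \<notin> X" by blast
    have "\<not> y ` I \<subseteq> X" using card_mono[OF X(1), of "y ` I"] lt cy by linarith
    then obtain c where c: "c \<in> y ` I" "c \<notin> X" by blast
    \<comment> \<open>The separator may contain elements outside \<open>W\<close>, whereas
      \<open>conn\<close> speaks of subsets of \<open>W\<close>.\<close>
    let ?S = "S \<union> X \<inter> W"
    have "card ?S \<le> card S + card X"
      using card_Un_le[of S "X \<inter> W"] card_mono[OF X(1) Int_lower1, of W] by linarith
    then have "card ?S < m" using lt S(2) by linarith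
    then obtain p where p: "rwalk E p" "set p \<subseteq> W - ?S" "hd p = a" "last p = c"
      using conn[of ?S a c] S(1) U(1) y(1) a c by blast
    then have "rwalk ?F p" by (intro rwalk_restrict) auto
    then have "set p \<inter> X \<noteq> {}" using X(2) p(3,4) a c unfolding separates_def by blast
    then show False using p(2) by blast
  qed
  ultimately obtain J :: "'a set" and Q where "card J = card I" "finite J" "connector ?F U (y ` I) J Q"
    using menger[of ?F U "y ` I" "card I"] fU by blast
  then obtain Q where Q: "connector ?F U (y ` I) (y ` I) Q" "\<And>c. c \<in> y ` I \<Longrightarrow> last (Q c) = c"
    using connector_by_last[of ?F U "y ` I" J Q] I cy by (metis finite_imageI)
  have "connector ?F U (y ` I) I (Q \<circ> y)"
    using connector_reindex[OF Q(1) y(2)] by simp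
  then have "linking ?F U y I (Q \<circ> y)"
    using Q(2) by (auto simp: linking_def connector_def rpath_def)
  then show ?thesis
    by (rule ex_has_least_nat[where P = "linking ?F U y I" and m = "\<lambda>P. \<Sum>i\<in>I. length (P i)"])
qed

section \<open>Linking the terminals\<close>

lemma card_Un5_le: "card (A \<union> B \<union> C \<union> D \<union> F) \<le> card A + card B + card C + card D + card F"
  by (meson card_Un_le order_trans add_mono order_refl)

lemma (in gadget_system) linkage:
  fixes x y :: "'i \<Rightarrow> 'a"
  assumes I: "finite I" "card I = k"
    and deg_W: "\<And>v. v \<in> W \<Longrightarrow> 21 * k \<le> card (out v W) + 14"
    and conn: "\<And>S a c. S \<subseteq> W \<Longrightarrow> card S < 10 * k - 2 \<Longrightarrow> a \<in> W - S \<Longrightarrow> c \<in> W - S \<Longrightarrow>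
      \<exists>p. rwalk E p \<and> set p \<subseteq> W - S \<and> hd p = a \<and> last p = c"
    and xy: "x ` I \<subseteq> W" "y ` I \<subseteq> W" "inj_on x I" "inj_on y I" "x ` I \<inter> y ` I = {}"
    and H: "H = W - x ` I - y ` I"
  shows "\<exists>L. (\<forall>i\<in>I. rwalk E (L i) \<and> hd (L i) = x i \<and> last (L i) = y i) \<and>
    disjoint_family_on (\<lambda>i. set (L i)) I"
proof -
  note fins = finite_sets I(1)
  have RH: "R \<subseteq> H" "R \<inter> Z = {}" "Z \<subseteq> H"
    using VH bV uV by (auto simp: R_def Z_def)
  have W_cover: "W \<subseteq> H \<union> x ` I \<union> y ` I" and H_disj: "x ` I \<inter> H = {}" "y ` I \<inter> H = {}"
    by (auto simp: H)
  have card_im: "card (f ` I) \<le> k" for f :: "'i \<Rightarrow> 'a"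
    using card_image_le[of I f] I by simp

  have "finite (out (x i) R) \<and> card I \<le> card (out (x i) R)" if i: "i \<in> I" for i
  proof
    show f: "finite (out (x i) R)" using fins by (simp add: out_def)
    \<comment> \<open>Of at least \<open>21 * k - 14\<close> out-neighbours at most
      \<open>9 * k - 3\<close> lie in gadgets and \<open>2 * k\<close> are terminals, which leaves
      \<open>10 * k - 11\<close>, at least \<open>k\<close>. The empty set pads the union for
      \<open>card_Un5_le\<close>.\<close>
    have "out (x i) W \<subseteq> out (x i) R \<union> Z \<union> x ` I \<union> y ` I \<union> {}"
      using W_cover by (auto simp: out_def R_def)
    then have "card (out (x i) W) \<le> card (out (x i) R \<union> Z \<union> x ` I \<union> y ` I \<union> {})"
      using fins f by (intro card_mono) auto
    also have "\<dots> \<le> card (out (x i) R) + card Z + card (x ` I) + card (y ` I) + card ({} :: 'a set)"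
      by (rule card_Un5_le)
    finally show "card I \<le> card (out (x i) R)"
      using deg_W[of "x i"] xy(1) i card_Z card_im[of x] card_im[of y] k2 I(2) by force
  qed
  with injective_choice[OF I(1), of "\<lambda>i. out (x i) R"] obtain x'
    where x': "inj_on x' I" "\<And>i. i \<in> I \<Longrightarrow> x' i \<in> out (x i) R" by blast
  then have x'E: "(x i, x' i) \<in> E" "x' i \<in> R" if "i \<in> I" for i
    using that by (auto simp: out_def)

  let ?lands = "\<lambda>i c. (x' i, c) \<in> E \<and> c \<in> R \<and> c \<notin> x' ` I \<and>
    card {v \<in> V. \<not> hits (x' i) v \<and> \<not> hits c v} < k"
  \<comment> \<open>The values already taken together with all \<open>x' i\<close> number fewer than
    \<open>2 * k\<close>, the allowance of \<open>exists_landing\<close>.\<close>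
  have "\<exists>g. inj_on g I \<and> (\<forall>i\<in>I. ?lands i (g i))"
  proof (rule greedy_injection[OF I(1)])
    fix i and B :: "'a set" assume i: "i \<in> I" and B: "finite B" "card B < card I"
    have f: "finite (B \<union> x' ` I)" using B(1) I(1) by simp
    have "card (B \<union> x' ` I) < 2 * k"
      using card_Un_le[of B "x' ` I"] card_im[of x'] B(2) I(2) by linarith
    from exists_landing[OF x'E(2)[OF i] f this] obtain c where "(x' i, c) \<in> E" "c \<in> R"
        "c \<notin> B \<union> x' ` I" "card {v \<in> V. \<not> hits (x' i) v \<and> \<not> hits c v} < k" .
    then show "\<exists>c. ?lands i c \<and> c \<notin> B" by blast
  qed
  then obtain x'' where x''_inj: "inj_on x'' I" and lands: "\<forall>i\<in>I. ?lands i (x'' i)"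
    by (elim exE conjE)
  note x'' = x''_inj bspec[OF lands]

  have xR: "x' ` I \<subseteq> R" "x'' ` I \<subseteq> R"
    using x'E(2) lands by (simp_all add: image_subset_iff)
  \<comment> \<open>Everything the paths to the sinks must avoid: \<open>3 * k\<close> vertices for
    the sources with \<open>x'\<close> and \<open>x''\<close>, and \<open>2 * (3 * k - 1)\<close>
    for \<open>V\<close> and \<open>b\<close>. The exits stay free as possible starts. Adding the
    \<open>k\<close> paths gives the bound \<open>10 * k - 2\<close>.\<close>
  define S where "S = x ` I \<union> x' ` I \<union> x'' ` I \<union> V \<union> b ` V"
  have S: "S \<subseteq> W"
    unfolding S_def using xy(1) subset_trans[OF xR(1)] subset_trans[OF xR(2)] RH(1) VH bV HW
    by (intro Un_least) auto
  have "card S \<le> card (x ` I) + card (x' ` I) + card (x'' ` I) + card V + card (b ` V)"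
    unfolding S_def by (rule card_Un5_le)
  then have cS: "card S + card I \<le> 10 * k - 2"
    using card_im[of x] card_im[of x'] card_im[of x''] card_image_le[OF fins(2), of b] cardV I k2
    by linarith
  have US: "u ` V \<subseteq> W - S"
  proof -
    have "u ` V \<inter> x ` I = {}" "u ` V \<inter> V = {}" using uV H_disj(1) by blast+
    moreover have "u ` V \<inter> x' ` I = {}" "u ` V \<inter> x'' ` I = {}"
      using xR RH(2) unfolding Z_def by blast+
    moreover have "u ` V \<inter> b ` V = {}" using b_u_disjoint by blast
    ultimately have "u ` V \<inter> S = {}" unfolding S_def Int_Un_distrib by simp
    then show ?thesis using uV HW by blast
  qed
  have yS: "y ` I \<subseteq> W - S"
  proof -
    have "y ` I \<inter> x ` I = {}" using xy(5) by blast
    moreover have "y ` I \<inter> x' ` I = {}" "y ` I \<inter> x'' ` I = {}"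
      using xR RH(1) H_disj(2) by blast+
    moreover have "y ` I \<inter> V = {}" "y ` I \<inter> b ` V = {}" using VH bV H_disj(2) by blast+
    ultimately have "y ` I \<inter> S = {}" unfolding S_def Int_Un_distrib by simp
    then show ?thesis using xy(2) by blast
  qed
  have cU: "card I \<le> card (u ` V)" using card_image[OF inj_u] cardV I k2 by simp
  define F where "F = E \<inter> (W - S) \<times> (W - S)"
  have "\<exists>P. linking F (u ` V) y I P \<and> (\<forall>P'. linking F (u ` V) y I P' \<longrightarrow>
      (\<Sum>i\<in>I. length (P i)) \<le> (\<Sum>i\<in>I. length (P' i)))"
    unfolding F_def by (rule exists_minimal_linking[OF conn S cS I(1) US cU yS xy(4)])
  then obtain P where P: "linking F (u ` V) y I P"
    and min: "\<And>P'. linking F (u ` V) y I P' \<Longrightarrow>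
      (\<Sum>i\<in>I. length (P i)) \<le> (\<Sum>i\<in>I. length (P' i))"
    by (elim exE conjE) simp
  have Pi: "rpath F (u ` V) {y i} (P i)" if "i \<in> I" for i using P that by (simp add: linking_def)
  have Pne: "P i \<noteq> []" if "i \<in> I" for i using rpath_nonempty[OF Pi[OF that]] .
  have PS: "set (P i) \<subseteq> W - S" if i: "i \<in> I" for i
  proof (rule rwalk_restricted_vertices)
    show "rwalk (E \<inter> (W - S) \<times> (W - S)) (P i)" using Pi[OF i] by (simp add: rpath_def F_def)
    show "hd (P i) \<in> W - S" using Pi[OF i] US by (auto simp: rpath_def)
  qed
  have Pdisj: "set (P i) \<inter> set (P j) = {}" if "i \<in> I" "j \<in> I" "i \<noteq> j" for i j
    using P that by (auto simp: linking_def disjoint_family_on_def)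
  have PU: "set (P i) \<inter> u ` V = {hd (P i)}" if "i \<in> I" for i
    using minimal_linking_start[OF I(1) P min that] .

  \<comment> \<open>The gadget at whose exit the path to \<open>y i\<close> begins.\<close>
  define s where "s = (\<lambda>i. inv_into V u (hd (P i)))"
  have s: "s i \<in> V" "u (s i) = hd (P i)" if "i \<in> I" for i
  proof -
    have "hd (P i) \<in> u ` V" using Pi[OF that] by (simp add: rpath_def)
    then show "s i \<in> V" "u (s i) = hd (P i)"
      unfolding s_def by (rule inv_into_into, rule f_inv_into_f)
  qed
  have sP: "u (s i) \<in> set (P i)" if "i \<in> I" for i using s(2)[OF that] Pne[OF that] by simp
  have s_ne: "s i \<noteq> s j" if "i \<in> I" "j \<in> I" "i \<noteq> j" for i j
    using sP[of i] sP[of j] Pdisj[OF that] that by auto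

  have "finite ({v \<in> V. hits (x' i) v \<or> hits (x'' i) v} - s ` I) \<and>
      card I \<le> card ({v \<in> V. hits (x' i) v \<or> hits (x'' i) v} - s ` I)" if i: "i \<in> I" for i
  proof
    let ?A = "{v \<in> V. hits (x' i) v \<or> hits (x'' i) v}" and ?B = "{v \<in> V. \<not> hits (x' i) v \<and> \<not> hits (x'' i) v}"
    show "finite (?A - s ` I)" using fins by simp
    have "card V = card (?A \<union> ?B)" by (intro arg_cong[of _ _ card]) blast
    also have "\<dots> = card ?A + card ?B" using fins by (intro card_Un_disjoint) auto
    finally have "2 * k \<le> card ?A" using x''(2)[OF i] cardV by linarith
    moreover have "card ?A - card (s ` I) \<le> card (?A - s ` I)"
      using fins by (intro diff_card_le_card_Diff) simp
    ultimately show "card I \<le> card (?A - s ` I)" using card_im[of s] I(2) by linarith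
  qed
  with injective_choice[OF I(1), of "\<lambda>i. {v \<in> V. hits (x' i) v \<or> hits (x'' i) v} - s ` I"] obtain m
    where m_inj: "inj_on m I"
      and m: "\<And>i. i \<in> I \<Longrightarrow> m i \<in> {v \<in> V. hits (x' i) v \<or> hits (x'' i) v} - s ` I" by blast
  have mV: "m i \<in> V" and mh: "hits (x' i) (m i) \<or> hits (x'' i) (m i)" if "i \<in> I" for i
    using m[OF that] by auto
  have ms: "m i \<noteq> s j" if "i \<in> I" "j \<in> I" for i j using m[OF that(1)] that(2) by auto
  have m_ne: "m i \<noteq> m j" if "i \<in> I" "j \<in> I" "i \<noteq> j" for i j using m_inj that by (auto simp: inj_on_def)
  have mP: "u (m i) \<notin> set (P j)" if i: "i \<in> I" and j: "j \<in> I" for i j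
  proof
    assume "u (m i) \<in> set (P j)"
    then have "u (m i) \<in> set (P j) \<inter> u ` V" using mV[OF i] by simp
    then have "u (m i) = u (s j)" unfolding PU[OF j] s(2)[OF j] by simp
    then show False using inj_u mV[OF i] s(1)[OF j] ms[OF i j] by (auto simp: inj_on_def)
  qed

  \<comment> \<open>The indices for which the exit \<open>u (m i)\<close> does not enter the gadget
    of \<open>s i\<close> directly and an intermediate vertex is needed.\<close>
  define K where "K = {i \<in> I. \<not> hits (u (m i)) (s i)}"
  \<comment> \<open>By minimality an intermediate vertex could meet a path only in its first two
    vertices. The first is an exit, hence outside \<open>R\<close>; the second is excluded here. On
    a one-vertex path \<open>P j ! 1\<close> is an unspecified value, which costs at most one more
    vertex.\<close>
  define B where "B = x' ` I \<union> x'' ` I \<union> (\<lambda>j. P j ! 1) ` I"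
  have KI: "finite K" "K \<subseteq> I" using I(1) by (auto simp: K_def)
  have cB: "finite B" "card B \<le> 3 * k"
  proof -
    show "finite B" using I(1) by (simp add: B_def)
    show "card B \<le> 3 * k"
      using card_Un_le[of "x' ` I \<union> x'' ` I" "(\<lambda>j. P j ! 1) ` I"] card_Un_le[of "x' ` I" "x'' ` I"]
        card_im[of x'] card_im[of x''] card_im[of "\<lambda>j. P j ! 1"] unfolding B_def by linarith
  qed
  have "finite {q \<in> R - B. (u (m i), q) \<in> E \<and> hits q (s i)} \<and>
      card K \<le> card {q \<in> R - B. (u (m i), q) \<in> E \<and> hits q (s i)}" if i: "i \<in> K" for i
  proof -
    have iI: "i \<in> I" using i KI by blast
    have "card K \<le> k" using card_mono[OF I(1) KI(2)] I(2) by simp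
    moreover have "\<not> hits (u (m i)) (s i)" using i by (simp add: K_def)
    ultimately show ?thesis
      using many_links[OF mV[OF iI] s(1)[OF iI] ms[OF iI iI] _ cB] fins by fastforce
  qed
  with injective_choice[OF KI(1), of "\<lambda>i. {q \<in> R - B. (u (m i), q) \<in> E \<and> hits q (s i)}"] obtain q
    where q_inj: "inj_on q K"
      and q: "\<And>i. i \<in> K \<Longrightarrow> q i \<in> {q \<in> R - B. (u (m i), q) \<in> E \<and> hits q (s i)}" by blast
  have qR: "q i \<in> R" "q i \<notin> B" "(u (m i), q i) \<in> E" "hits (q i) (s i)" if "i \<in> K" for i
    using q[OF that] by auto
  have qP: "q i \<notin> set (P j)" if i: "i \<in> K" and j: "j \<in> I" for i j
  proof
    assume qp: "q i \<in> set (P j)"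
    have iI: "i \<in> I" using i KI by blast
    have "(u (m i), q i) \<in> F" using qR(3)[OF i] PS[OF j] qp US mV[OF iI] by (auto simp: F_def)
    from minimal_linking_unused_start[OF I(1) P min j _ mP[OF iI] qp this]
    have "q i = P j ! 0 \<or> q i = P j ! 1" using mV[OF iI] by blast
    moreover have "q i \<noteq> P j ! 1" using qR(2)[OF i] j by (auto simp: B_def)
    moreover have "u (s j) \<in> Z" using s(1)[OF j] by (simp add: Z_def)
    then have "q i \<noteq> P j ! 0"
      using qR(1)[OF i] s(2)[OF j] Pne[OF j] RH(2) by (auto simp: hd_conv_nth)
    ultimately show False by blast
  qed

  define land where "land = (\<lambda>i. x i # x' i #
    (if hits (x' i) (m i) then route (x' i) (m i) else x'' i # route (x'' i) (m i)))"
  define link where "link = (\<lambda>i. u (m i) #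
    (if i \<in> K then q i # route (q i) (s i) else route (u (m i)) (s i)))"
  define L where "L = (\<lambda>i. land i @ link i @ P i)"
  have "rwalk E (L i) \<and> hd (L i) = x i \<and> last (L i) = y i" if i: "i \<in> I" for i
  proof -
    have w1: "rwalk E (land i @ [u (m i)])"
      using rwalk_route[OF mV[OF i]] mh[OF i] x'E[OF i] x''(2)[OF i]
      by (auto simp: land_def rwalk_def)
    have w2: "rwalk E (link i @ [u (s i)])"
      using rwalk_route[OF s(1)[OF i]] qR[of i] i by (auto simp: link_def rwalk_def K_def)
    have "rwalk F (P i)" using Pi[OF i] by (simp add: rpath_def)
    then have w3: "rwalk E (P i)" by (rule rwalk_mono) (auto simp: F_def)
    have P_Cons: "P i = u (s i) # tl (P i)" using s(2)[OF i] Pne[OF i] by simp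
    have link_Cons: "link i = u (m i) # tl (link i)" by (simp add: link_def)
    have "rwalk E (link i @ P i)"
      using w2 w3 P_Cons rwalk_split[of E "link i" "u (s i)" "tl (P i)"] by simp
    then have "rwalk E (L i)"
      using w1 link_Cons rwalk_split[of E "land i" "u (m i)" "tl (link i) @ P i"]
      unfolding L_def by (metis append_Cons)
    moreover have "hd (L i) = x i" by (simp add: L_def land_def)
    moreover have "last (L i) = y i" using Pi[OF i] Pne[OF i] by (simp add: L_def rpath_def)
    ultimately show ?thesis by blast
  qed
  moreover have "disjoint_family_on (\<lambda>i. set (L i)) I"
    unfolding disjoint_family_on_def
  proof (intro ballI impI)
    fix i j assume ij: "i \<in> I" "j \<in> I" "i \<noteq> j"
    \<comment> \<open>The walks are compared by the location of their vertices: \<open>X i\<close>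
      lies in \<open>S\<close> off the gadgets, \<open>G i\<close> in \<open>Z\<close>, and
      \<open>Q i\<close> in \<open>R\<close>. \<open>X i\<close> contains \<open>x'' i\<close> even
      when the walk skips it.\<close>
    define X where "X = (\<lambda>i. {x i, x' i, x'' i})"
    define G where "G = (\<lambda>i. {m i, b (m i), u (m i), s i, b (s i)})"
    define Q where "Q = (\<lambda>i. if i \<in> K then {q i} else {})"
    have L: "set (L i) \<subseteq> X i \<union> G i \<union> Q i \<union> set (P i)" for i
      using set_route by (fastforce simp: L_def land_def link_def X_def G_def Q_def split: if_splits)
    have X_in: "X i \<subseteq> S" "X i \<inter> Z = {}" if i: "i \<in> I" for i
    proof -
      show "X i \<subseteq> S" using i by (auto simp: X_def S_def)
      have "x i \<notin> H" using i H_disj by auto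
      then show "X i \<inter> Z = {}" using RH x'E(2)[OF i] x''(2)[OF i] by (auto simp: X_def)
    qed
    have G_in: "G i \<subseteq> Z" "G i \<inter> set (P j) = {}" if i: "i \<in> I" and j: "j \<in> I" for i j
    proof -
      show "G i \<subseteq> Z" using mV[OF i] s(1)[OF i] by (auto simp: G_def Z_def)
      have "{m i, b (m i), s i, b (s i)} \<subseteq> S" using mV[OF i] s(1)[OF i] by (auto simp: S_def)
      then show "G i \<inter> set (P j) = {}" using mP[OF i j] PS[OF j] by (auto simp: G_def)
    qed
    have Q_in: "Q i \<subseteq> R" "Q i \<inter> X j = {}" "Q i \<inter> set (P j) = {}" if i: "i \<in> I" and j: "j \<in> I" for i j
    proof -
      show "Q i \<subseteq> R" using qR(1) by (auto simp: Q_def)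
      have "x j \<notin> R" using j RH H_disj by auto
      moreover have "x' j \<in> B" "x'' j \<in> B" using j by (auto simp: B_def)
      ultimately show "Q i \<inter> X j = {}" using qR(1,2)[of i] by (auto simp: Q_def X_def)
      show "Q i \<inter> set (P j) = {}" using qP j by (auto simp: Q_def)
    qed
    have XX: "X i \<inter> X j = {}"
    proof -
      have "x i \<noteq> x j" "x' i \<noteq> x' j" "x'' i \<noteq> x'' j"
        using ij xy(3) x'(1) x''(1) by (auto simp: inj_on_def)
      moreover have "x i \<notin> R" "x j \<notin> R" using ij RH H_disj by auto
      moreover have "x' i \<in> R" "x' j \<in> R" "x'' i \<in> R" "x'' j \<in> R"
        using x'E(2) x''(2) ij by auto
      moreover have "x'' i \<noteq> x' j" "x'' j \<noteq> x' i" using x''(2) ij by (metis imageI)+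
      ultimately show ?thesis by (auto simp: X_def)
    qed
    have GG: "G i \<inter> G j = {}"
    proof -
      have n: "m i \<noteq> m j" "s i \<noteq> s j" "m i \<noteq> s j" "s i \<noteq> m j"
        using m_ne[OF ij] s_ne[OF ij] ms[OF ij(1,2)] ms[OF ij(2,1)] by auto
      have v: "m i \<in> V" "m j \<in> V" "s i \<in> V" "s j \<in> V" using mV s(1) ij by auto
      have "b v \<noteq> b w" "u v \<noteq> u w" if "v \<in> V" "w \<in> V" "v \<noteq> w" for v w
        using inj_b inj_u that by (auto simp: inj_on_def)
      moreover have "b v \<noteq> w" "u v \<noteq> w" "b v \<noteq> u w" if "v \<in> V" "w \<in> V" for v w
        using bV uV b_u_disjoint that by auto
      ultimately show ?thesis using n v unfolding G_def by (auto; metis)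
    qed
    have QQ: "Q i \<inter> Q j = {}" using q_inj ij by (auto simp: Q_def inj_on_def)
    have "X i \<inter> G j = {}" "G i \<inter> X j = {}" using X_in G_in ij by blast+
    moreover have "X i \<inter> Q j = {}" "Q i \<inter> X j = {}" using Q_in(2) ij by blast+
    moreover have "X i \<inter> set (P j) = {}" "set (P i) \<inter> X j = {}" using X_in(1) PS ij by blast+
    moreover have "G i \<inter> Q j = {}" "Q i \<inter> G j = {}" using G_in(1) Q_in(1) RH(2) ij by blast+
    moreover have "G i \<inter> set (P j) = {}" "set (P i) \<inter> G j = {}" using G_in(2) ij by blast+
    moreover have "Q i \<inter> set (P j) = {}" "set (P i) \<inter> Q j = {}" using Q_in(3) ij by blast+
    moreover have "set (P i) \<inter> set (P j) = {}" using Pdisj[OF ij] .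
    ultimately have "(X i \<union> G i \<union> Q i \<union> set (P i)) \<inter> (X j \<union> G j \<union> Q j \<union> set (P j)) = {}"
      using XX GG QQ by (simp add: Int_Un_distrib Int_Un_distrib2)
    then show "set (L i) \<inter> set (L j) = {}" using L[of i] L[of j] by blast
  qed
  ultimately show ?thesis by blast
qed

text \<open>Sets up the gadget system. Removing the terminals lowers each out-degree by at most
  \<open>2 * k\<close>, and the remaining \<open>19 * k - 14\<close> is at least
  \<open>3 * (3 * k - 1)\<close>, as \<open>exists_gadgets\<close> requires.\<close>

lemma (in finite_tournament) exists_linkage:
  fixes x y :: "'i \<Rightarrow> 'a"
  assumes I: "finite I" "card I = k" "2 \<le> k"
    and deg: "\<And>v. v \<in> W \<Longrightarrow> 21 * k \<le> card (out v W) + 14"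
    and conn: "\<And>S a c. S \<subseteq> W \<Longrightarrow> card S < 10 * k - 2 \<Longrightarrow> a \<in> W - S \<Longrightarrow> c \<in> W - S \<Longrightarrow>
      \<exists>p. rwalk E p \<and> set p \<subseteq> W - S \<and> hd p = a \<and> last p = c"
    and xy: "x ` I \<subseteq> W" "y ` I \<subseteq> W" "inj_on x I" "inj_on y I" "x ` I \<inter> y ` I = {}"
  shows "\<exists>L. (\<forall>i\<in>I. rwalk E (L i) \<and> hd (L i) = x i \<and> last (L i) = y i) \<and>
    disjoint_family_on (\<lambda>i. set (L i)) I"
proof -
  define H where "H = W - x ` I - y ` I"
  have HW: "H \<subseteq> W" by (auto simp: H_def)
  have finH: "finite H" using HW fin by (rule finite_subset)
  have card_im: "card (f ` I) \<le> k" for f :: "'i \<Rightarrow> 'a"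
    using card_image_le[of I f] I by simp
  have in_H: "card A \<le> card (A \<inter> H) + 2 * k" if "A \<subseteq> W" for A
  proof -
    have "A \<subseteq> (A \<inter> H) \<union> x ` I \<union> y ` I" using that by (auto simp: H_def)
    then have "card A \<le> card ((A \<inter> H) \<union> x ` I \<union> y ` I)"
      using finH I(1) by (intro card_mono) auto
    also have "\<dots> \<le> card (A \<inter> H) + card (x ` I) + card (y ` I)"
      by (meson card_Un_le order_trans add_mono order_refl)
    finally show ?thesis using card_im[of x] card_im[of y] by linarith
  qed
  have deg_H: "19 * k \<le> card (out z H) + 14" if "z \<in> W" for z
  proof -
    have "out z W \<inter> H = out z H" using HW by (auto simp: out_def)
    then show ?thesis using in_H[OF out_subset, of z] deg[OF that] by simp
  qed
  have "I \<noteq> {}" using I by auto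
  then obtain i where "i \<in> I" by blast
  then have "19 * k \<le> card (out (x i) H) + 14" using deg_H xy(1) by blast
  also have "card (out (x i) H) \<le> card H" using finH out_subset by (rule card_mono)
  finally have "3 * k - 1 \<le> card H" using I(3) by linarith
  then obtain V where V: "V \<subseteq> H" "card V = 3 * k - 1"
      "\<And>v z. v \<in> V \<Longrightarrow> z \<in> H - V \<Longrightarrow> card (out v H) \<le> card (out z H)"
    using lowest_subset[OF finH, of "3 * k - 1" "\<lambda>v. card (out v H)"] by metis
  have "3 * card V \<le> card (out v H)" if "v \<in> V" for v
  proof -
    have "v \<in> W" using that V(1) HW by blast
    from deg_H[OF this] show ?thesis using V(2) I(3) by linarith
  qed
  from exists_gadgets[OF HW V(1) this] obtain b u where
    g: "inj_on b V" "inj_on u V" "b ` V \<inter> u ` V = {}"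
    "b ` V \<subseteq> H - V" "u ` V \<subseteq> H - V"
    "\<forall>v\<in>V. (v, b v) \<in> E \<and> (v, u v) \<in> E \<and> (b v, u v) \<in> E"
    "\<forall>v\<in>V.
      4 * card {z \<in> H - V - b ` V - u ` V. (v, z) \<in> E \<and> (b v, z) \<in> E \<and> (u v, z) \<in> E}
        \<le> card (out v H)" .
  interpret gadget_system W E k H V b u
  proof unfold_locales
    show "19 * k \<le> card (out z H) + 14" if "z \<in> H" for z using deg_H that HW by blast
  qed (use I(3) HW V g in simp_all)
  show ?thesis by (rule linkage[OF I(1,2) deg conn xy H_def])
qed

section \<open>Transfer to digraphs\<close>

lemma rwalk_iff_vwalk_arcs: "rwalk E p \<longleftrightarrow> p \<noteq> [] \<and> set (vwalk_arcs p) \<subseteq> E"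
proof (induction p)
  case (Cons a p)
  then show ?case by (cases p) (auto simp: rwalk_def)
qed (simp add: rwalk_def)

lemma (in tournament) finite_tournament: "finite_tournament (verts T) (arcs_ends T)"
proof
  show "finite (verts T)" by (rule finite_verts)
  show "arcs_ends T \<subseteq> verts T \<times> verts T" by (auto dest: adj_in_verts)
  show "(u, u) \<notin> arcs_ends T" for u using adj_not_same by blast
  show "(u, v) \<in> arcs_ends T \<or> (v, u) \<in> arcs_ends T"
    if "u \<in> verts T" "v \<in> verts T" "u \<noteq> v" for u v
    using unique_arc[OF that] unfolding arcs_ends_def by (metis image_eqI)
  show "(v, u) \<notin> arcs_ends T" if uv: "(u, v) \<in> arcs_ends T" for u v
  proof
    assume vu: "(v, u) \<in> arcs_ends T"
    from uv vu obtain e f where e: "e \<in> arcs T" "arc_to_ends T e = (u, v)"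
      and f: "f \<in> arcs T" "arc_to_ends T f = (v, u)" by (auto simp: arcs_ends_def)
    have "u \<in> verts T" "v \<in> verts T" "u \<noteq> v" using uv adj_in_verts adj_not_same by blast+
    from unique_arc[OF this] e f have "e = f" by blast
    then show False using e(2) f(2) \<open>u \<noteq> v\<close> by simp
  qed
qed

text \<open>Without parallel arcs, \<open>head T\<close> is injective on the arcs leaving
  \<open>v\<close>.\<close>

lemma (in tournament) out_degree_eq: "out_degree T v = card {z \<in> verts T. (v, z) \<in> arcs_ends T}"
proof -
  have "inj_on (head T) (out_arcs T v)"
    using no_multi_arcs by (auto simp: inj_on_def arc_to_ends_def)
  moreover have "head T ` out_arcs T v = {z \<in> verts T. (v, z) \<in> arcs_ends T}"
    by (force simp: arcs_ends_def arc_to_ends_def)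
  ultimately show ?thesis unfolding out_degree_def by (metis card_image)
qed

lemma (in tournament) m_connected_walk:
  assumes "m_connected m T" "S \<subseteq> verts T" "card S < m" "a \<in> verts T - S" "c \<in> verts T - S"
  shows "\<exists>p. rwalk (arcs_ends T) p \<and> set p \<subseteq> verts T - S \<and> hd p = a \<and> last p = c"
proof -
  let ?G = "T \<restriction> (verts T - S)"
  interpret G: wf_digraph ?G by (rule wellformed_induce_subgraph)
  have "finite S" using assms(2) finite_verts by (rule finite_subset)
  then have "strongly_connected ?G" using assms by (auto simp: m_connected_def)
  then obtain p where "dipath ?G a p c"
    using assms(4,5) G.strongly_connected_iff_dipath by auto
  then have p: "vwalk p ?G" "hd p = a" "last p = c" by (auto simp: dipath_def vpath_def)
  have "arcs_ends ?G \<subseteq> arcs_ends T" by (auto simp: arcs_ends_def arc_to_ends_def)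
  then show ?thesis using p by (auto simp: vwalk_def rwalk_iff_vwalk_arcs)
qed

theorem theorem1p1:
  fixes k :: nat and T :: "('a, 'b) pre_digraph"
  assumes "k \<ge> 1"
    and "tournament T"
    and "m_connected (nat \<lceil>12.5 * real k - 6\<rceil>) T"
    and "int (min_out_degree T) \<ge> 21 * int k - 14"
  shows "k_linked k T"
  unfolding k_linked_def
proof (intro allI impI, elim conjE)
  fix x y :: "nat \<Rightarrow> 'a"
  let ?I = "{1..k}" and ?W = "verts T" and ?E = "arcs_ends T"
  assume xy: "x ` ?I \<subseteq> ?W" "y ` ?I \<subseteq> ?W" "inj_on x ?I" "inj_on y ?I" "x ` ?I \<inter> y ` ?I = {}"
  interpret T: tournament T by fact
  interpret finite_tournament ?W ?E by (rule T.finite_tournament)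
  note conn = T.m_connected_walk[OF assms(3)]
  have "\<exists>L. (\<forall>i\<in>?I. rwalk ?E (L i) \<and> hd (L i) = x i \<and> last (L i) = y i) \<and>
      disjoint_family_on (\<lambda>i. set (L i)) ?I"
  proof (cases "k = 1")
    case True
    \<comment> \<open>For a single pair of terminals strong connectedness suffices, with nothing
      removed.\<close>
    have "\<exists>p. rwalk ?E p \<and> set p \<subseteq> ?W - {} \<and> hd p = x 1 \<and> last p = y 1"
      using xy True by (intro conn) auto
    then obtain p where "rwalk ?E p" "hd p = x 1" "last p = y 1" by blast
    then show ?thesis using True
      by (intro exI[of _ "\<lambda>_. p"]) (auto simp: disjoint_family_on_def)
  next
    case False
    then have k: "2 \<le> k" using assms(1) by simp
    have deg: "21 * k \<le> card (out v ?W) + 14" if "v \<in> ?W" for v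
    proof -
      have "min_out_degree T \<le> out_degree T v"
        unfolding min_out_degree_def using that by (intro Min_le) auto
      then show ?thesis using assms(4) by (simp add: T.out_degree_eq out_def)
    qed
    \<comment> \<open>Equivalent to \<open>2.5 * k\<close> being at least 4, which holds from
      \<open>k = 2\<close> on.\<close>
    have "10 * real k - 2 \<le> 12.5 * real k - 6" using k by simp
    then have "10 * real k - 2 \<le> real_of_int \<lceil>12.5 * real k - 6\<rceil>" using le_of_int_ceiling by (rule order_trans)
    then have m: "10 * k - 2 \<le> nat \<lceil>12.5 * real k - 6\<rceil>" using k by linarith
    have "\<exists>p. rwalk ?E p \<and> set p \<subseteq> ?W - S \<and> hd p = a \<and> last p = c"
      if "S \<subseteq> ?W" "card S < 10 * k - 2" "a \<in> ?W - S" "c \<in> ?W - S" for S a c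
      using conn that m by simp
    from exists_linkage[OF _ _ k deg this xy] show ?thesis by simp
  qed
  then obtain L where L: "\<And>i. i \<in> ?I \<Longrightarrow> rwalk ?E (L i) \<and> hd (L i) = x i \<and> last (L i) = y i"
    and disj: "disjoint_family_on (\<lambda>i. set (L i)) ?I" by blast
  \<comment> \<open>The \<open>L i\<close> are known only to be walks; shortening each to a path
    within its own vertices keeps them disjoint.\<close>
  obtain P where P: "connector ?E UNIV UNIV ?I P"
      "\<And>i. i \<in> ?I \<Longrightarrow> hd (P i) = hd (L i) \<and> last (P i) = last (L i) \<and> set (P i) \<subseteq> set (L i)"
    using connector_from_walks[of ?I ?E L UNIV UNIV] L disj by blast
  have "dipath T (x i) (P i) (y i)" if i: "i \<in> ?I" for i
  proof -
    have w: "rwalk ?E (P i)" "distinct (P i)" using P(1) i by (auto simp: connector_def rpath_def)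
    have e: "hd (P i) = x i" "last (P i) = y i" using P(2)[OF i] L[OF i] by auto
    have "x i \<in> ?W" using xy(1) i by blast
    then have "set (P i) \<subseteq> ?W" using rwalk_in_vertices[OF w(1)] e(1) by simp
    then show ?thesis using w e by (auto simp: dipath_def vpath_def vwalk_def rwalk_iff_vwalk_arcs)
  qed
  then show "\<exists>P. (\<forall>i\<in>?I. dipath T (x i) (P i) (y i)) \<and> disjoint_family_on (\<lambda>i. set (P i)) ?I"
    using P(1) unfolding connector_def by blast
qed

end
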